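(* There exists an analytic space $X_\infty\subset 2^\omega\times[0,1]$ for which the set $\mathcal F_0(X_\infty)$ is $\boldsymbol{\Sigma}^1_2$-complete.
   Context: All spaces are separable metrizable. A space is analytic if it is homeomorphic to an analytic ($\boldsymbol\Sigma^1_1$) subset of a Polish space. A space is zero-dimensional if it has a basis of clopen sets; the empty space counts as zero-dimensional. $\mathcal F(X)$ is the set of all closed subsets of $X$, and $\mathcal F_0(X)\subset\mathcal F(X)$ is the set of all zero-dimensional closed subsets of $X$. $\mathcal F(X)$ is endowed with an admissible topology: take a compact metrizable space $\hat X\supset X$ (with $X$ a subspace, not necessarily dense), identify $F\in\mathcal F(X)$ with its closure $\overline F$ in $\hat X$, and give $\mathcal F(X)$ the topology induced by the Vietoris (Hausdorff metric) topology on the compact subsets of $\hat X$; an admissible topology is one obtained in this way from some $\hat X$. $\boldsymbol\Sigma^1_2$ sets are the projections of co-analytic sets. $\mathcal F_0(X)$ being $\boldsymbol\Sigma^1_2$ means it is a $\boldsymbol\Sigma^1_2$ subset of a (any) Polish space in which $\mathcal F(X)$ embeds. For a class $\Gamma$, $\mathcal F_0(X)$ is $\Gamma$-hard if for every $A\subset 2^\omega$ in $\Gamma$ there is a continuous $\varphi:2^\omega\to\mathcal F(X)$ with $A=\varphi^{-1}(\mathcal F_0(X))$; it is $\Gamma$-complete if it is $\Gamma$-hard and in $\Gamma$. *)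

theory Defs
  imports "HOL-Analysis.Analysis"
begin

definition Polish_space :: "'a topology \<Rightarrow> bool" where
  "Polish_space P \<longleftrightarrow> completely_metrizable_space P \<and> separable_space P"

text \<open>The type \<^typ>\<open>nat \<Rightarrow> nat\<close> with its product topology is the Baire space, and
  \<^typ>\<open>nat \<Rightarrow> bool\<close> is the Cantor space (\<^typ>\<open>nat\<close> and \<^typ>\<open>bool\<close> are discrete).\<close>

abbreviation Baire_space :: "(nat \<Rightarrow> nat) topology" where
  "Baire_space \<equiv> euclidean"

abbreviation Cantor_space :: "(nat \<Rightarrow> bool) topology" where
  "Cantor_space \<equiv> euclidean"

text \<open>The projective classes, for subsets of a Polish space \<open>P\<close>; as usual, projections are taken
  along the Baire space.\<close>

definition analytic_in :: "'a topology \<Rightarrow> 'a set \<Rightarrow> bool" where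
  "analytic_in P A \<longleftrightarrow> (\<exists>C. closedin (prod_topology P Baire_space) C \<and> A = fst ` C)"

definition coanalytic_in :: "'a topology \<Rightarrow> 'a set \<Rightarrow> bool" where
  "coanalytic_in P A \<longleftrightarrow> A \<subseteq> topspace P \<and> analytic_in P (topspace P - A)"

definition Sigma12_in :: "'a topology \<Rightarrow> 'a set \<Rightarrow> bool" where
  "Sigma12_in P A \<longleftrightarrow> (\<exists>B. coanalytic_in (prod_topology P Baire_space) B \<and> A = fst ` B)"

text \<open>In the next definition and in \<open>Sigma12_subset\<close> below, the Polish space lives on the same
  type as the given space. This is no restriction as soon as that type has at least the cardinality
  of the continuum, since every Polish space then has a homeomorphic copy on the type.\<close>

definition analytic_space :: "'a topology \<Rightarrow> bool" where
  "analytic_space S \<longleftrightarrow>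
     (\<exists>(P :: 'a topology) A. Polish_space P \<and> analytic_in P A \<and>
        S homeomorphic_space subtopology P A)"

text \<open>A basis of clopen sets; the empty space qualifies.\<close>

definition zero_dimensional :: "'a topology \<Rightarrow> bool" where
  "zero_dimensional S \<longleftrightarrow>
     (\<exists>\<B>. (\<forall>V\<in>\<B>. openin S V \<and> closedin S V) \<and>
        (\<forall>U x. openin S U \<and> x \<in> U \<longrightarrow> (\<exists>V\<in>\<B>. x \<in> V \<and> V \<subseteq> U)))"

definition closed_subsets :: "'a topology \<Rightarrow> 'a set set" where
  "closed_subsets S = {F. closedin S F}"

definition zero_dim_closed_subsets :: "'a topology \<Rightarrow> 'a set set" where
  "zero_dim_closed_subsets S = {F \<in> closed_subsets S. zero_dimensional (subtopology S F)}"

text \<open>The Vietoris topology on the compact subsets; the empty set is included, as an isolated point.\<close>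

definition Vietoris :: "'a topology \<Rightarrow> 'a set topology" where
  "Vietoris T = topology_generated_by
     ({{K. compactin T K \<and> K \<subseteq> U} |U. openin T U} \<union>
      {{K. compactin T K \<and> K \<inter> U \<noteq> {}} |U. openin T U})"

text \<open>\<open>H\<close> is the topology induced on the closed subsets of \<open>S\<close> by identifying \<open>F\<close> with its closure
  in a compact metrizable superspace \<open>T\<close> of \<open>S\<close>. The superspace uses points of the same type; up to
  a homeomorphism fixing \<open>S\<close> this is every compact metrizable superspace, provided that the
  complement of \<open>S\<close> in the type has at least the cardinality of the continuum. That is the case
  for subsets of \<open>UNIV \<times> {0..1}\<close> in \<^typ>\<open>(nat \<Rightarrow> bool) \<times> real\<close>.\<close>

definition admissible_topology :: "'a topology \<Rightarrow> 'a set topology \<Rightarrow> bool" where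
  "admissible_topology S H \<longleftrightarrow>
     (\<exists>T. compact_space T \<and> metrizable_space T \<and>
        topspace S \<subseteq> topspace T \<and> subtopology T (topspace S) = S \<and>
        H = pullback_topology (closed_subsets S) (\<lambda>F. T closure_of F) (Vietoris T))"

text \<open>\<open>A\<close> is \<open>\<Sigma>\<^sup>1\<^sub>2\<close> in one, and in every, Polish space in which \<open>H\<close> embeds. Both parts are required,
  so that the notion is not vacuous.\<close>

definition Sigma12_subset :: "'a topology \<Rightarrow> 'a set \<Rightarrow> bool" where
  "Sigma12_subset H A \<longleftrightarrow>
     A \<subseteq> topspace H \<and>
     (\<exists>(P :: 'a topology) e. Polish_space P \<and> embedding_map H P e \<and> Sigma12_in P (e ` A)) \<and>
     (\<forall>(P :: 'a topology) e. Polish_space P \<and> embedding_map H P e \<longrightarrow> Sigma12_in P (e ` A))"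

definition Sigma12_hard :: "'a topology \<Rightarrow> 'a set \<Rightarrow> bool" where
  "Sigma12_hard H B \<longleftrightarrow>
     (\<forall>A. Sigma12_in Cantor_space A \<longrightarrow>
        (\<exists>\<phi>. continuous_map Cantor_space H \<phi> \<and> A = \<phi> -` B))"

definition Sigma12_complete :: "'a topology \<Rightarrow> 'a set \<Rightarrow> bool" where
  "Sigma12_complete H B \<longleftrightarrow> Sigma12_hard H B \<and> Sigma12_subset H B"

end

theory Submission
  imports Defs
begin

text \<open>The fibre of \<open>X\<^sub>\<infinity>\<close> over a point \<open>x\<close> of a nowhere dense Cantor set is \<open>[0,1]\<close> minus the rational
  translates of a continuous injective image of \<open>{y. \<forall>z. (x, y, z) \<notin> Q}\<close>, where \<open>Q\<close> is a universal closed set.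
  Hence it is zero-dimensional if \<open>\<exists>y. \<forall>z. (x, y, z) \<notin> Q\<close>, a universal \<open>\<Sigma>\<^sup>1\<^sub>2\<close> condition, and it is the
  whole interval otherwise. The fibre does not depend continuously on \<open>x\<close> in an arbitrary admissible
  topology. Given a compactification, choose for each \<open>n\<close> a finite \<open>2\<^sup>-\<^sup>n\<close>-net, in its metric, of the
  points of \<open>X\<^sub>\<infinity>\<close> that lie off the fibres over the Cantor set and agree with \<open>x\<close> below \<open>n\<close>. The union
  of these nets with the fibre is a closed set which is Hausdorff continuous in \<open>x\<close>, and whose points
  off the fibre are isolated.

  Conversely, a closed subset \<open>F\<close> of an analytic \<open>X\<close> is zero-dimensional if and only if there is a
  sequence of pairs of open sets such that each point of \<open>F\<close> satisfies a Borel condition saying that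
  the pairs cut \<open>F\<close> into clopen sets which form a basis. As \<open>F\<close> ranges over the points of an analytic
  set, this is a \<open>\<Sigma>\<^sup>1\<^sub>2\<close> condition on any code of \<open>F\<close> as the closure of a sequence.\<close>

section \<open>Analytic sets\<close>

lemma analytic_in_closedin:
  assumes "closedin P A" shows "analytic_in P A"
proof -
  have "closedin (prod_topology P Baire_space) (A \<times> UNIV)"
    using assms by (simp add: closedin_prod_Times_iff)
  then show ?thesis
    unfolding analytic_in_def by (intro exI[of _ "A \<times> UNIV"]) auto
qed

lemma analytic_in_preimage:
  assumes A: "analytic_in P A" and f: "continuous_map Q P f"
  shows "analytic_in Q {x \<in> topspace Q. f x \<in> A}"
proof -
  obtain C where C: "closedin (prod_topology P Baire_space) C" "A = fst ` C"
    using A unfolding analytic_in_def by blast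
  let ?D = "{u \<in> topspace (prod_topology Q Baire_space). (f (fst u), snd u) \<in> C}"
  have "continuous_map (prod_topology Q Baire_space) (prod_topology P Baire_space)
      (\<lambda>u. (f (fst u), snd u))"
    by (intro continuous_map_pairedI continuous_map_compose[OF continuous_map_fst f, unfolded o_def]
        continuous_map_snd)
  then have "closedin (prod_topology Q Baire_space) ?D"
    using C(1) by (rule closedin_continuous_map_preimage)
  moreover have "{x \<in> topspace Q. f x \<in> A} = fst ` ?D"
    using C(2) by (force simp: image_iff)
  ultimately show ?thesis
    unfolding analytic_in_def by blast
qed

text \<open>One point of the Baire space can store several witnesses as subsequences. The maps that
  read them off have this form.\<close>

lemma continuous_map_Baire_reindex:
  "continuous_map (prod_topology P Baire_space) (prod_topology P Baire_space)
     (\<lambda>u. (fst u, \<lambda>k. snd u (r k)))"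
proof -
  have "continuous_map Baire_space Baire_space (\<lambda>z k. z (r k))"
    by (auto intro!: continuous_intros)
  then show ?thesis
    by (intro continuous_map_pairedI continuous_map_fst
        continuous_map_compose[OF continuous_map_snd, unfolded o_def])
qed

text \<open>Entry \<open>0\<close> of the new witness names a member of the union, and the remaining
  entries are a witness for this member.\<close>

lemma analytic_in_UN:
  assumes "\<And>n::nat. analytic_in P (A n)"
  shows "analytic_in P (\<Union>n. A n)"
proof -
  let ?PB = "prod_topology P Baire_space"
  obtain C where C: "\<And>n. closedin ?PB (C n)" "\<And>n. A n = fst ` C n"
    using assms unfolding analytic_in_def by metis
  define g :: "'a \<times> (nat \<Rightarrow> nat) \<Rightarrow> 'a \<times> (nat \<Rightarrow> nat)" where "g = (\<lambda>u. (fst u, \<lambda>k. snd u (Suc k)))"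
  have g: "continuous_map ?PB ?PB g"
    unfolding g_def by (rule continuous_map_Baire_reindex)
  let ?D = "{u \<in> topspace ?PB. g u \<in> C (snd u 0)}"
  have op: "openin ?PB {u \<in> topspace ?PB. snd u 0 = n}" for n
  proof -
    have "continuous_map ?PB euclidean (\<lambda>u. snd u 0)"
      by (rule continuous_map_compose[OF continuous_map_snd, unfolded o_def])
        (simp add: continuous_intros)
    from openin_continuous_map_preimage[OF this, of "{n}"] show ?thesis
      by (simp add: open_discrete)
  qed
  \<comment> \<open>Entry \<open>0\<close> is locally constant, so near any point only one of the
    conditions \<open>g u \<in> C n\<close> is in force.\<close>
  have "topspace ?PB - ?D =
      (\<Union>n. {u \<in> topspace ?PB. snd u 0 = n} \<inter> {u \<in> topspace ?PB. g u \<in> topspace ?PB - C n})"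
    by (auto simp: g_def)
  also have "openin ?PB \<dots>"
    by (intro openin_Union) (use op openin_continuous_map_preimage[OF g openin_diff[OF openin_topspace C(1)]] in blast)
  finally have "closedin ?PB ?D"
    by (auto simp: closedin_def)
  moreover have "(\<Union>n. A n) = fst ` ?D"
  proof (intro subset_antisym subsetI)
    fix x assume "x \<in> (\<Union>n. A n)"
    then obtain n z where nz: "(x, z) \<in> C n"
      using C(2) by fastforce
    then have "x \<in> topspace P"
      using closedin_subset[OF C(1)[of n]] by auto
    with nz show "x \<in> fst ` ?D"
      by (intro image_eqI[of _ _ "(x, case_nat n z)"]) (auto simp: g_def)
  next
    fix x assume "x \<in> fst ` ?D"
    then show "x \<in> (\<Union>n. A n)"
      using C(2) by (force simp: g_def)
  qed
  ultimately show ?thesis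
    unfolding analytic_in_def by blast
qed

text \<open>A single sequence stores a witness for every \<open>A n\<close> at once, as its
  \<open>n\<close>-th row under the pairing function.\<close>

lemma analytic_in_INT:
  assumes "\<And>n::nat. analytic_in P (A n)"
  shows "analytic_in P (\<Inter>n. A n)"
proof -
  let ?PB = "prod_topology P Baire_space"
  obtain C where C: "\<And>n. closedin ?PB (C n)" "\<And>n. A n = fst ` C n"
    using assms unfolding analytic_in_def by metis
  define g :: "nat \<Rightarrow> 'a \<times> (nat \<Rightarrow> nat) \<Rightarrow> 'a \<times> (nat \<Rightarrow> nat)"
    where "g n = (\<lambda>u. (fst u, \<lambda>k. snd u (prod_encode (n, k))))" for n
  have g: "continuous_map ?PB ?PB (g n)" for n
    unfolding g_def by (rule continuous_map_Baire_reindex)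
  let ?D = "\<Inter>n. {u \<in> topspace ?PB. g n u \<in> C n}"
  have "closedin ?PB ?D"
    by (rule closedin_Inter) (use closedin_continuous_map_preimage[OF g C(1)] in blast)+
  moreover have "(\<Inter>n. A n) = fst ` ?D"
  proof (intro subset_antisym subsetI)
    fix x assume "x \<in> (\<Inter>n. A n)"
    then have "\<forall>n. \<exists>z. (x, z) \<in> C n"
      using C(2) by fastforce
    then obtain z where z: "\<And>n. (x, z n) \<in> C n"
      by metis
    then have "x \<in> topspace P"
      using closedin_subset[OF C(1)[of 0]] by auto
    with z show "x \<in> fst ` ?D"
      by (intro image_eqI[of _ _ "(x, \<lambda>m. case prod_decode m of (n, k) \<Rightarrow> z n k)"])
        (auto simp: g_def)
  next
    fix x assume "x \<in> fst ` ?D"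
    then show "x \<in> (\<Inter>n. A n)"
      using C(2) by (force simp: g_def)
  qed
  ultimately show ?thesis
    unfolding analytic_in_def by blast
qed

lemma analytic_in_Un:
  assumes "analytic_in P A" "analytic_in P B" shows "analytic_in P (A \<union> B)"
proof -
  have "A \<union> B = (\<Union>n::nat. if n = 0 then A else B)" by auto
  with analytic_in_UN[of P "\<lambda>n. if n = 0 then A else B"] assms show ?thesis by simp
qed

lemma analytic_in_Int:
  assumes "analytic_in P A" "analytic_in P B" shows "analytic_in P (A \<inter> B)"
proof -
  have "A \<inter> B = (\<Inter>n::nat. if n = 0 then A else B)" by (auto split: if_splits)
  with analytic_in_INT[of P "\<lambda>n. if n = 0 then A else B"] assms show ?thesis by simp
qed

text \<open>Two successive projections along the Baire space merge into one: the even entries hold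
  the coordinate that is projected away, the odd entries the witness.\<close>

lemma analytic_in_projection:
  assumes "analytic_in (prod_topology P Baire_space) A"
  shows "analytic_in P (fst ` A)"
proof -
  let ?PB = "prod_topology P Baire_space"
  obtain C where C: "closedin (prod_topology ?PB Baire_space) C" "A = fst ` C"
    using assms unfolding analytic_in_def by blast
  define g :: "'a \<times> (nat \<Rightarrow> nat) \<Rightarrow> ('a \<times> (nat \<Rightarrow> nat)) \<times> (nat \<Rightarrow> nat)"
    where "g = (\<lambda>u. ((fst u, \<lambda>k. snd u (2 * k)), \<lambda>k. snd u (2 * k + 1)))"
  have "continuous_map Baire_space Baire_space (\<lambda>z k. z (2 * k + 1))"
    by (auto intro!: continuous_intros)
  then have "continuous_map ?PB (prod_topology ?PB Baire_space) g"
    unfolding g_def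
    by (intro continuous_map_pairedI[OF continuous_map_Baire_reindex]
        continuous_map_compose[OF continuous_map_snd, unfolded o_def])
  then have "closedin ?PB {u \<in> topspace ?PB. g u \<in> C}"
    using C(1) by (rule closedin_continuous_map_preimage)
  moreover have "fst ` A = fst ` {u \<in> topspace ?PB. g u \<in> C}"
  proof (intro subset_antisym subsetI)
    fix x assume "x \<in> fst ` A"
    then obtain y z where yz: "((x, y), z) \<in> C"
      using C(2) by fastforce
    then have "x \<in> topspace P"
      using closedin_subset[OF C(1)] by auto
    moreover have "g (x, \<lambda>m. if even m then y (m div 2) else z (m div 2)) = ((x, y), z)"
      by (simp add: g_def)
    ultimately show "x \<in> fst ` {u \<in> topspace ?PB. g u \<in> C}"
      using yz by (intro image_eqI[of _ _ "(x, \<lambda>m. if even m then y (m div 2) else z (m div 2))"]) auto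
  next
    fix x assume "x \<in> fst ` {u \<in> topspace ?PB. g u \<in> C}"
    then obtain u where "fst u = x" "g u \<in> C" by auto
    then show "x \<in> fst ` A"
      using C(2) by (auto simp: g_def image_iff intro!: bexI[of _ "g u"])
  qed
  ultimately show ?thesis
    unfolding analytic_in_def by blast
qed

text \<open>In a metrizable space an open set is a countable union of closed sets.\<close>

lemma analytic_in_openin:
  assumes "metrizable_space P" "openin P A" shows "analytic_in P A"
proof -
  obtain F :: "nat \<Rightarrow> 'a set" where F: "\<forall>n. closedin P (F n)" "A = (\<Union>n. F n)"
    using open_imp_fsigma_in[OF assms] by (auto simp only: fsigma_in_ascending)
  show ?thesis
    unfolding F(2) using F(1) by (intro analytic_in_UN analytic_in_closedin) simp
qed

text \<open>The sets that are analytic together with their complements form a \<sigma>-algebra, and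
  it contains the open sets.\<close>

lemma analytic_in_borel:
  fixes A :: "'a::topological_space set"
  assumes "metrizable_space (euclidean :: 'a topology)" "A \<in> sets borel"
  shows "analytic_in euclidean A"
proof -
  have "A \<in> sigma_sets UNIV {S. open S}"
    using assms(2) by (simp add: borel_def)
  then have "analytic_in euclidean A \<and> analytic_in euclidean (- A)"
  proof induction
    case (Basic a)
    then show ?case
      using analytic_in_openin[OF assms(1), of a]
        analytic_in_closedin[of euclidean "- a"] by (simp add: closed_Compl)
  next
    case Empty
    then show ?case by (auto intro!: analytic_in_closedin)
  next
    case (Compl a)
    then show ?case by (simp add: Compl_eq_Diff_UNIV[symmetric])
  next
    case (Union a)
    then show ?case by (simp add: analytic_in_UN analytic_in_INT)
  qed
  then show ?thesis ..
qed

section \<open>The Vietoris topology\<close>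

lemma topspace_Vietoris: "topspace (Vietoris T) = {K. compactin T K}"
proof -
  have "{K. compactin T K} = {K. compactin T K \<and> K \<subseteq> topspace T}"
    using compactin_subset_topspace by blast
  then have "{K. compactin T K} \<in> {{K. compactin T K \<and> K \<subseteq> U} |U. openin T U}"
    by (intro CollectI exI[of _ "topspace T"]) simp
  then show ?thesis
    unfolding Vietoris_def topology_generated_by_topspace by auto
qed

lemma openin_Vietoris_subset:
  "openin T U \<Longrightarrow> openin (Vietoris T) {K. compactin T K \<and> K \<subseteq> U}"
  unfolding Vietoris_def
  by (intro topology_generated_by_Basis UnI1 CollectI exI[of _ U] conjI refl)

lemma openin_Vietoris_meets:
  "openin T U \<Longrightarrow> openin (Vietoris T) {K. compactin T K \<and> K \<inter> U \<noteq> {}}"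
  unfolding Vietoris_def
  by (intro topology_generated_by_Basis UnI2 CollectI exI[of _ U] conjI refl)

lemma continuous_map_Vietoris:
  assumes "\<And>z. z \<in> topspace Z \<Longrightarrow> compactin T (f z)"
    and "\<And>U. openin T U \<Longrightarrow> openin Z {z \<in> topspace Z. f z \<subseteq> U}"
    and "\<And>U. openin T U \<Longrightarrow> openin Z {z \<in> topspace Z. f z \<inter> U \<noteq> {}}"
  shows "continuous_map Z (Vietoris T) f"
  unfolding Vietoris_def
proof (rule continuous_on_generated_topo)
  fix \<U> assume "\<U> \<in> {{K. compactin T K \<and> K \<subseteq> U} |U. openin T U} \<union>
      {{K. compactin T K \<and> K \<inter> U \<noteq> {}} |U. openin T U}"
  then obtain U where U: "openin T U"
    "\<U> = {K. compactin T K \<and> K \<subseteq> U} \<or> \<U> = {K. compactin T K \<and> K \<inter> U \<noteq> {}}"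
    by blast
  have "f -` {K. compactin T K \<and> K \<subseteq> U} \<inter> topspace Z = {z \<in> topspace Z. f z \<subseteq> U}"
    "f -` {K. compactin T K \<and> K \<inter> U \<noteq> {}} \<inter> topspace Z = {z \<in> topspace Z. f z \<inter> U \<noteq> {}}"
    using assms(1) by auto
  with U(2) show "openin Z (f -` \<U> \<inter> topspace Z)"
    using assms(2,3)[OF U(1)] by auto
next
  show "f ` topspace Z \<subseteq> \<Union> ({{K. compactin T K \<and> K \<subseteq> U} |U. openin T U} \<union>
      {{K. compactin T K \<and> K \<inter> U \<noteq> {}} |U. openin T U})"
    using assms(1) topspace_Vietoris[of T]
    unfolding Vietoris_def topology_generated_by_topspace by auto
qed

text \<open>Continuity for the Hausdorff distance, tested on sets that need not be closed. That
  \<open>A z'\<close> stays close to \<open>A z\<close> gives the condition on inclusion in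
  \<open>U\<close>; that \<open>A z\<close> stays close to \<open>A z'\<close> gives the condition
  on meeting \<open>U\<close>.\<close>

lemma (in Metric_space) continuous_map_Vietoris_closure:
  assumes comp: "compact_space mtopology"
    and A: "\<And>z. z \<in> topspace Z \<Longrightarrow> A z \<subseteq> M"
    and near: "\<And>z \<epsilon>. z \<in> topspace Z \<Longrightarrow> \<epsilon> > 0 \<Longrightarrow> \<exists>W. openin Z W \<and> z \<in> W \<and>
      (\<forall>z'\<in>W. (\<forall>p\<in>A z. \<exists>p'\<in>A z'. d p p' < \<epsilon>) \<and> (\<forall>p'\<in>A z'. \<exists>p\<in>A z. d p p' < \<epsilon>))"
  shows "continuous_map Z (Vietoris mtopology) (\<lambda>z. mtopology closure_of A z)"
proof (rule continuous_map_Vietoris)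
  show "compactin mtopology (mtopology closure_of A z)" for z
    using comp by (simp add: closedin_compact_space)
next
  fix U assume U: "openin mtopology U"
  show "openin Z {z \<in> topspace Z. mtopology closure_of A z \<subseteq> U}"
  proof (subst openin_subopen, intro ballI)
    fix z assume "z \<in> {z \<in> topspace Z. mtopology closure_of A z \<subseteq> U}"
    then have z: "z \<in> topspace Z" "mtopology closure_of A z \<subseteq> U" by auto
    \<comment> \<open>The closure is compact, so a Lebesgue number for the cover \<open>{U}\<close>
      gives one radius for all its points. Half of it is spent on moving from \<open>A z\<close> to
      \<open>A z'\<close>, half on passing to a limit of \<open>A z'\<close>.\<close>
    obtain \<epsilon> where \<epsilon>: "\<epsilon> > 0" "\<And>p. p \<in> mtopology closure_of A z \<Longrightarrow> mball p \<epsilon> \<subseteq> U"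
    proof -
      have "compactin mtopology (mtopology closure_of A z)"
        using comp by (simp add: closedin_compact_space)
      from lebesgue_number[OF this, of "{U}"] z(2) U that show thesis
        by auto
    qed
    obtain W where W: "openin Z W" "z \<in> W"
      and near': "\<And>z' p'. z' \<in> W \<Longrightarrow> p' \<in> A z' \<Longrightarrow> \<exists>p\<in>A z. d p p' < \<epsilon> / 2"
      using near[OF z(1), of "\<epsilon> / 2"] \<epsilon>(1) by auto
    have "mtopology closure_of A z' \<subseteq> U" if z': "z' \<in> W" for z'
    proof
      fix q assume "q \<in> mtopology closure_of A z'"
      then have "q \<in> M" "\<forall>r>0. \<exists>y\<in>A z'. y \<in> mball q r"
        by (auto simp: metric_closure_of)
      then obtain p' where q: "q \<in> M" "p' \<in> A z'" "p' \<in> mball q (\<epsilon> / 2)"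
        using \<epsilon>(1) half_gt_zero by blast
      moreover obtain p where p: "p \<in> A z" "d p p' < \<epsilon> / 2"
        using near'[OF z' q(2)] by blast
      moreover have "p \<in> M" "p \<in> mtopology closure_of A z"
        using A[OF z(1)] p(1) closure_of_subset[of "A z" mtopology] by auto
      moreover have "d p q < \<epsilon>"
        using triangle[of p p' q] q p \<open>p \<in> M\<close> by (auto simp: commute)
      ultimately show "q \<in> U"
        using \<epsilon>(2)[of p] by auto
    qed
    then show "\<exists>W. openin Z W \<and> z \<in> W \<and> W \<subseteq> {z \<in> topspace Z. mtopology closure_of A z \<subseteq> U}"
      using W openin_subset[OF W(1)] by (intro exI[of _ W]) auto
  qed
next
  fix U assume U: "openin mtopology U"
  show "openin Z {z \<in> topspace Z. mtopology closure_of A z \<inter> U \<noteq> {}}"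
  proof (subst openin_subopen, intro ballI)
    fix z assume "z \<in> {z \<in> topspace Z. mtopology closure_of A z \<inter> U \<noteq> {}}"
    then have z: "z \<in> topspace Z" "A z \<inter> U \<noteq> {}"
      using openin_Int_closure_of_eq_empty[OF U, of "A z"] by auto
    then obtain p where p: "p \<in> A z" "p \<in> U" by blast
    then obtain \<epsilon> where \<epsilon>: "\<epsilon> > 0" "mball p \<epsilon> \<subseteq> U"
      using U by (auto simp: openin_mtopology)
    obtain W where W: "openin Z W" "z \<in> W"
      and near': "\<And>z' p. z' \<in> W \<Longrightarrow> p \<in> A z \<Longrightarrow> \<exists>p'\<in>A z'. d p p' < \<epsilon>"
      using near[OF z(1) \<epsilon>(1)] by blast
    have "mtopology closure_of A z' \<inter> U \<noteq> {}" if z': "z' \<in> W" for z'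
    proof -
      have z'Z: "z' \<in> topspace Z" using W(1) z' openin_subset by blast
      obtain p' where "p' \<in> A z'" "d p p' < \<epsilon>"
        using near'[OF z' p(1)] by blast
      then have "p' \<in> A z' \<inter> U"
        using A[OF z(1)] A[OF z'Z] p(1) \<epsilon>(2) by (auto simp: subset_iff)
      then show ?thesis
        using openin_Int_closure_of_eq_empty[OF U, of "A z'"] by auto
    qed
    then show "\<exists>W. openin Z W \<and> z \<in> W \<and> W \<subseteq> {z \<in> topspace Z. mtopology closure_of A z \<inter> U \<noteq> {}}"
      using W openin_subset[OF W(1)] by (intro exI[of _ W]) auto
  qed
qed

section \<open>Compactness and metrizability of the Vietoris topology\<close>

lemma topology_generated_by_eq_subbase:
  "topology (arbitrary union_of (finite intersection_of (\<lambda>x. x \<in> \<B>) relative_to \<Union>\<B>)) =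
    topology_generated_by \<B>"
proof -
  have "(arbitrary union_of (finite intersection_of (\<lambda>x. x \<in> \<B>) relative_to \<Union>\<B>)) A \<longleftrightarrow>
      generate_topology_on \<B> A" for A
  proof
    assume "(arbitrary union_of (finite intersection_of (\<lambda>x. x \<in> \<B>) relative_to \<Union>\<B>)) A"
    then obtain \<U> where \<U>: "A = \<Union>\<U>"
      and U: "\<And>U. U \<in> \<U> \<Longrightarrow> (finite intersection_of (\<lambda>x. x \<in> \<B>) relative_to \<Union>\<B>) U"
      by (auto simp: union_of_def)
    have "generate_topology_on \<B> U" if U\<U>: "U \<in> \<U>" for U
    proof -
      have top: "generate_topology_on \<B> (\<Union>\<B>)"
        by (intro generate_topology_on.UN generate_topology_on.Basis)
      obtain \<F> where \<F>: "finite \<F>" "\<F> \<subseteq> \<B>" "U = \<Union>\<B> \<inter> \<Inter>\<F>"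
        using U[OF U\<U>] by (auto simp: relative_to_def intersection_of_def)
      show ?thesis
      \<comment> \<open>The two descriptions differ in the empty intersection, which relative to
        \<open>\<Union>\<B>\<close> is the whole space.\<close>
      proof (cases "\<F> = {}")
        case True
        with \<F>(3) top show ?thesis by simp
      next
        case False
        then have "generate_topology_on \<B> (\<Inter>\<F>)"
          using \<F> by (intro generate_topology_on_Inter generate_topology_on.Basis) auto
        with \<F>(3) top show ?thesis by (simp add: generate_topology_on.Int)
      qed
    qed
    then show "generate_topology_on \<B> A"
      unfolding \<U> by (rule generate_topology_on.UN)
  next
    assume "generate_topology_on \<B> A"
    then obtain \<U> where \<U>: "A = \<Union>\<U>"
      and U: "\<And>U. U \<in> \<U> \<Longrightarrow> (finite' intersection_of (\<lambda>x. x \<in> \<B>)) U"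
      by (auto simp: generate_topology_on_eq union_of_def)
    have "(finite intersection_of (\<lambda>x. x \<in> \<B>) relative_to \<Union>\<B>) U" if U\<U>: "U \<in> \<U>" for U
    proof -
      obtain \<F> where \<F>: "finite \<F>" "\<F> \<noteq> {}" "\<F> \<subseteq> \<B>" "U = \<Inter>\<F>"
        using U[OF U\<U>] by (auto simp: intersection_of_def)
      then have "U = \<Union>\<B> \<inter> \<Inter>\<F>" by blast
      with \<F> show ?thesis
        unfolding relative_to_def intersection_of_def
        by (intro exI[of _ "\<Inter>\<F>"] conjI exI[of _ \<F>]) auto
    qed
    then show "(arbitrary union_of (finite intersection_of (\<lambda>x. x \<in> \<B>) relative_to \<Union>\<B>)) A"
      unfolding \<U> union_of_def by (intro exI[of _ \<U>] conjI) (simp_all add: subset_iff arbitrary_def)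
  qed
  then show ?thesis
    by (intro arg_cong[of _ _ topology] ext) simp
qed

text \<open>Alexander's subbase lemma. For a cover by subbasic sets, let \<open>K0\<close> consist
  of the points outside every \<open>V\<close> with \<open>meets V\<close> in the cover. No such
  \<open>meets V\<close> contains the compact set \<open>K0\<close>, so some \<open>sub U\<close>
  does, even if \<open>K0\<close> is empty. The complement of \<open>U\<close> is then compact and
  covered by finitely many of the sets \<open>V\<close>; their \<open>meets V\<close> together with
  \<open>sub U\<close> form a finite cover.\<close>

lemma compact_space_Vietoris:
  assumes T: "compact_space T"
  shows "compact_space (Vietoris T)"
proof -
  define sub where "sub = (\<lambda>U. {K. compactin T K \<and> K \<subseteq> U})"
  define meets where "meets = (\<lambda>U. {K. compactin T K \<and> K \<inter> U \<noteq> {}})"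
  define B where "B = sub ` Collect (openin T) \<union> meets ` Collect (openin T)"
  have V: "Vietoris T = topology_generated_by B"
    unfolding Vietoris_def B_def sub_def meets_def by (simp add: setcompr_eq_image)
  have mem_sub: "K \<in> sub U \<longleftrightarrow> compactin T K \<and> K \<subseteq> U"
    and mem_meets: "K \<in> meets U \<longleftrightarrow> compactin T K \<and> K \<inter> U \<noteq> {}" for K U
    by (auto simp: sub_def meets_def)
  have UB: "\<Union>B = {K. compactin T K}"
    using topspace_Vietoris[of T] unfolding V topology_generated_by_topspace .
  have fin: "\<exists>C'. finite C' \<and> C' \<subseteq> C \<and> \<Union>C' = \<Union>B" if C: "C \<subseteq> B" "\<Union>C = \<Union>B" for C
  proof -
    define \<V> where "\<V> = {V. openin T V \<and> meets V \<in> C}"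
    define K0 where "K0 = topspace T - \<Union>\<V>"
    have "closedin T K0"
      unfolding K0_def \<V>_def by (intro closedin_diff closedin_topspace openin_Union) auto
    then have "K0 \<in> \<Union>C"
      using T closedin_compact_space C(2) UB by auto
    then obtain c where c: "c \<in> C" "K0 \<in> c" by blast
    have "c \<noteq> meets V" if "openin T V" for V
    proof
      assume "c = meets V"
      then have "V \<in> \<V>" "K0 \<inter> V \<noteq> {}"
        using c that by (simp_all add: \<V>_def mem_meets)
      then show False unfolding K0_def by auto
    qed
    moreover have "c \<in> B" using c(1) C(1) by (rule subsetD[rotated])
    ultimately obtain U where U: "openin T U" "c = sub U"
      unfolding B_def by auto
    have "compactin T (topspace T - U)"
      using T U(1) closedin_compact_space by blast
    moreover have "topspace T - U \<subseteq> \<Union>\<V>"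
      using c(2) unfolding U(2) mem_sub K0_def by blast
    moreover have "\<And>V. V \<in> \<V> \<Longrightarrow> openin T V"
      by (simp add: \<V>_def)
    ultimately obtain \<F> where \<F>: "finite \<F>" "\<F> \<subseteq> \<V>" "topspace T - U \<subseteq> \<Union>\<F>"
      using compactinD by metis
    have "\<Union>(insert c (meets ` \<F>)) = \<Union>B"
    proof
      show "\<Union>(insert c (meets ` \<F>)) \<subseteq> \<Union>B"
        unfolding UB U(2) by (auto simp: mem_sub mem_meets)
      show "\<Union>B \<subseteq> \<Union>(insert c (meets ` \<F>))"
        unfolding UB
      proof
        fix K assume "K \<in> {K. compactin T K}"
        then have K: "compactin T K" by simp
        show "K \<in> \<Union>(insert c (meets ` \<F>))"
        proof (cases "K \<subseteq> U")
          case False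
          then obtain p where "p \<in> K" "p \<in> topspace T - U"
            using compactin_subset_topspace[OF K] by blast
          then obtain V where "V \<in> \<F>" "p \<in> K \<inter> V"
            using \<F>(3) by blast
          then have "K \<in> meets V" using K by (auto simp: mem_meets)
          with \<open>V \<in> \<F>\<close> show ?thesis by blast
        qed (use K U(2) mem_sub in auto)
      qed
    qed
    moreover have "finite (insert c (meets ` \<F>))" "insert c (meets ` \<F>) \<subseteq> C"
      using \<F>(1,2) c(1) by (auto simp: \<V>_def)
    ultimately show ?thesis by blast
  qed
  show ?thesis
  proof (rule Alexander_subbase)
    show "topology (arbitrary union_of (finite intersection_of (\<lambda>x. x \<in> B) relative_to \<Union>B)) = Vietoris T"
      unfolding V by (rule topology_generated_by_eq_subbase)
    show "\<exists>C'. finite C' \<and> C' \<subseteq> C \<and> \<Union>C' = topspace (Vietoris T)"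
      if "C \<subseteq> B" "\<Union>C = topspace (Vietoris T)" for C
      using fin[of C] that UB by (simp add: topspace_Vietoris)
  qed
qed

lemma (in Metric_space) compact_space_countable_dense:
  assumes "compact_space mtopology"
  obtains C where "countable C" "C \<subseteq> M" "\<And>p \<epsilon>. p \<in> M \<Longrightarrow> \<epsilon> > 0 \<Longrightarrow> \<exists>c\<in>C. d c p < \<epsilon>"
proof -
  have "mtotally_bounded M"
    using assms by (simp add: compact_space_eq_mcomplete_mtotally_bounded)
  then have "\<forall>n. \<exists>K. finite K \<and> K \<subseteq> M \<and> M \<subseteq> (\<Union>x\<in>K. mball x (inverse (Suc n)))"
    unfolding mtotally_bounded_def by simp
  then obtain K where K: "\<And>n. finite (K n)" "\<And>n. K n \<subseteq> M"
    "\<And>n. M \<subseteq> (\<Union>x\<in>K n. mball x (inverse (Suc n)))"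
    by metis
  show thesis
  proof (rule that[of "\<Union>n. K n"])
    show "countable (\<Union>n. K n)" using K(1) by (simp add: countable_finite)
    show "(\<Union>n. K n) \<subseteq> M" using K(2) by blast
    fix p and \<epsilon> :: real assume p: "p \<in> M" "\<epsilon> > 0"
    obtain n where n: "inverse (real (Suc n)) < \<epsilon>"
      using reals_Archimedean[OF p(2)] by auto
    obtain c where "c \<in> K n" "d c p < inverse (Suc n)"
      using K(3)[of n] p(1) by auto
    then show "\<exists>c\<in>(\<Union>n. K n). d c p < \<epsilon>"
      using n by (intro bexI[of _ c]) auto
  qed
qed

text \<open>A compact set is determined by its distances to the points of a countable dense set.
  This gives a continuous injection of a compact space into a countable power of the line, hence an
  embedding.\<close>

lemma (in Metric_space) metrizable_space_Vietoris:
  assumes comp: "compact_space mtopology"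
  shows "metrizable_space (Vietoris mtopology)"
proof -
  obtain C where C: "countable C" "C \<subseteq> M"
    and dense: "\<And>p \<epsilon>. p \<in> M \<Longrightarrow> \<epsilon> > 0 \<Longrightarrow> \<exists>c\<in>C. d c p < \<epsilon>"
    using compact_space_countable_dense[OF comp] by blast
  \<comment> \<open>Inserting \<open>1\<close> truncates the distance and gives the empty set a
    value as well.\<close>
  define f where "f K = (\<lambda>c\<in>C. Inf (insert 1 (d c ` K)))" for K
  have bdd: "bdd_below (insert 1 (d c ` K))" for c K
    by (intro bdd_belowI[of _ "min 0 1"]) auto
  have comp_f: "continuous_map (Vietoris mtopology) euclideanreal (\<lambda>K. f K c)" if c: "c \<in> C" for c
    unfolding continuous_map_upper_lower_semicontinuous_lt
  proof (intro conjI allI)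
    have cM: "c \<in> M" using c C(2) by blast
    have fc: "f K c = Inf (insert 1 (d c ` K))" for K
      using c by (simp add: f_def)
    fix a :: real
    \<comment> \<open>The gap between \<open>a\<close> and \<open>b\<close> keeps the infimum above
      \<open>a\<close>, although strict bounds on the single distances only bound the infimum
      weakly.\<close>
    have "{K \<in> topspace (Vietoris mtopology). f K c > a} =
        (if a < 1 then (\<Union>b\<in>{a<..}. {K. compactin mtopology K \<and> K \<subseteq> {x \<in> M. d c x > b}}) else {})"
    proof (cases "a < 1")
      case True
      have "(f K c > a) \<longleftrightarrow> (\<exists>b>a. K \<subseteq> {x \<in> M. d c x > b})" if K: "compactin mtopology K" for K
      proof
        assume a: "f K c > a"
        have "(a + f K c) / 2 < d c x" if "x \<in> K" for x
        proof -
          have "f K c \<le> d c x"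
            unfolding fc using that by (intro cInf_lower bdd) auto
          with a show ?thesis by simp
        qed
        then show "\<exists>b>a. K \<subseteq> {x \<in> M. d c x > b}"
          using compactin_subset_topspace[OF K] a by (intro exI[of _ "(a + f K c) / 2"]) auto
      next
        assume "\<exists>b>a. K \<subseteq> {x \<in> M. d c x > b}"
        then obtain b where b: "b > a" "K \<subseteq> {x \<in> M. d c x > b}" by blast
        then have "min 1 b \<le> f K c"
          unfolding fc by (intro cInf_greatest) (auto simp: subset_iff min_le_iff_disj less_imp_le)
        with b(1) True show "f K c > a" by auto
      qed
      with True show ?thesis by (auto simp: topspace_Vietoris)
    next
      case False
      have "f K c \<le> 1" for K
        unfolding fc by (intro cInf_lower bdd) auto
      with False have "\<not> f K c > a" for K
        using order_trans[of a "f K c" 1] by (smt (verit))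
      with False show ?thesis by auto
    qed
    moreover have "openin mtopology {x \<in> M. d c x > b}" for b
    proof -
      have "{x \<in> M. d c x > b} = topspace mtopology - mcball c b"
        using cM by auto
      then show ?thesis by (metis closedin_mcball openin_diff openin_topspace)
    qed
    ultimately show "openin (Vietoris mtopology) {K \<in> topspace (Vietoris mtopology). f K c > a}"
      by (auto intro!: openin_Union openin_Vietoris_subset)
    have "{K \<in> topspace (Vietoris mtopology). f K c < a} =
        (if a > 1 then topspace (Vietoris mtopology)
         else {K. compactin mtopology K \<and> K \<inter> mball c a \<noteq> {}})"
    proof -
      have "f K c < a \<longleftrightarrow> 1 < a \<or> K \<inter> mball c a \<noteq> {}" if "compactin mtopology K" for K
      proof -
        have "f K c < a \<longleftrightarrow> (\<exists>x\<in>insert 1 (d c ` K). x < a)"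
          unfolding fc by (intro cInf_less_iff bdd) auto
        then show ?thesis
          using compactin_subset_topspace[OF that] cM by (auto simp: disjoint_iff)
      qed
      then show ?thesis by (auto simp: topspace_Vietoris)
    qed
    then show "openin (Vietoris mtopology) {K \<in> topspace (Vietoris mtopology). f K c < a}"
      by (simp add: openin_Vietoris_meets)
  qed
  have "continuous_map (Vietoris mtopology) (powertop_real C) f"
    unfolding continuous_map_componentwise using comp_f by (auto simp: f_def)
  moreover have "inj_on f (topspace (Vietoris mtopology))"
  proof -
    have sub: "L \<subseteq> K" if K: "compactin mtopology K" and L: "compactin mtopology L" and eq: "f K = f L" for K L
    proof
      fix p assume p: "p \<in> L"
      then have pM: "p \<in> M" using compactin_subset_topspace[OF L] by auto
      show "p \<in> K"
      proof (rule ccontr)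
        assume "p \<notin> K"
        have "closedin mtopology K"
          using K Hausdorff_space_mtopology compactin_imp_closedin by blast
        then have "openin mtopology (M - K)"
          by (metis openin_diff openin_topspace topspace_mtopology)
        then obtain r where r: "r > 0" "mball p r \<subseteq> M - K"
          using pM \<open>p \<notin> K\<close> by (auto simp: openin_mtopology)
        \<comment> \<open>A dense point \<open>c\<close> within \<open>\<epsilon>\<close> of
          \<open>p\<close> has distance less than \<open>\<epsilon>\<close> to \<open>L\<close> but
          at least \<open>\<epsilon>\<close> to \<open>K\<close>, which misses the ball of radius
          \<open>r\<close> about \<open>p\<close>. The bound \<open>1\<close> makes this survive the
          truncation.\<close>
        define \<epsilon> where "\<epsilon> = min (r / 2) 1"
        have \<epsilon>: "\<epsilon> > 0" "2 * \<epsilon> \<le> r" "\<epsilon> \<le> 1" using r(1) by (auto simp: \<epsilon>_def)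
        obtain c where c: "c \<in> C" "d c p < \<epsilon>"
          using dense[OF pM \<epsilon>(1)] by blast
        have cM: "c \<in> M" using c C by blast
        have "f L c \<le> d c p"
          using c(1) p unfolding f_def by (auto intro!: cInf_lower bdd)
        moreover have "\<epsilon> \<le> f K c"
        proof -
          have "\<epsilon> \<le> d c x" if x: "x \<in> K" for x
          proof -
            have "x \<in> M" using x compactin_subset_topspace[OF K] by auto
            moreover have "x \<notin> mball p r" using r(2) x by blast
            ultimately have "r \<le> d p x" using pM by simp
            also have "\<dots> \<le> d c p + d c x"
              using triangle'[of p c x] \<open>x \<in> M\<close> pM cM by (metis commute triangle)
            finally show ?thesis using c(2) \<epsilon>(2) by linarith
          qed
          then show ?thesis
            using c(1) \<epsilon>(3) unfolding f_def by (auto intro!: cInf_greatest)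
        qed
        ultimately show False using c(2) eq by simp
      qed
    qed
    then show ?thesis
      unfolding topspace_Vietoris
      by (intro inj_onI subset_antisym sub) simp_all
  qed
  moreover have "metrizable_space (powertop_real C)"
    using C(1) by (auto simp: metrizable_space_product_topology metrizable_space_euclidean
        intro: countable_subset[of _ C])
  ultimately have "embedding_map (Vietoris mtopology) (powertop_real C) f"
    using compact_space_Vietoris[OF comp] metrizable_imp_Hausdorff_space
    by (intro continuous_imp_embedding_map) auto
  then have "Vietoris mtopology homeomorphic_space
      subtopology (powertop_real C) (f ` topspace (Vietoris mtopology))"
    by (rule embedding_map_imp_homeomorphic_space)
  then show ?thesis
    using homeomorphic_metrizable_space metrizable_space_subtopology
      \<open>metrizable_space (powertop_real C)\<close> by metis
qed

lemma Polish_space_compact: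
  assumes "compact_space P" "metrizable_space P"
  shows "Polish_space P"
proof -
  obtain M d where "Metric_space M d" and P: "P = Metric_space.mtopology M d"
    using assms(2) unfolding metrizable_space_def by blast
  then interpret Metric_space M d by simp
  have comp: "compact_space mtopology" using assms(1) P by simp
  obtain C where C: "countable C" "C \<subseteq> M"
    and dense: "\<And>p \<epsilon>. p \<in> M \<Longrightarrow> \<epsilon> > 0 \<Longrightarrow> \<exists>c\<in>C. d c p < \<epsilon>"
    using compact_space_countable_dense[OF comp] by blast
  have "p \<in> mtopology closure_of C" if "p \<in> M" for p
    unfolding metric_closure_of
    using that dense C(2) by (fastforce simp: commute)
  then have "mtopology closure_of C = topspace mtopology"
    using closure_of_subset_topspace[of mtopology C] by auto
  moreover have "completely_metrizable_space mtopology"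
    using comp compact_space_eq_mcomplete_mtotally_bounded completely_metrizable_space_mtopology by blast
  ultimately show ?thesis
    unfolding Polish_space_def separable_space_def P using C by auto
qed

section \<open>The Baire space\<close>

lemma open_cylinder: "open {y::nat \<Rightarrow> 'a::discrete_topology. \<forall>k<n. y k = a k}"
proof -
  have "{y. \<forall>k<n. y k = a k} = (\<Inter>k\<in>{..<n}. (\<lambda>y. y k) -` {a k})"
    by auto
  also have "open \<dots>"
    by (intro open_INT ballI open_vimage) (auto intro: open_discrete)
  finally show ?thesis .
qed

lemma closed_cylinder: "closed {y::nat \<Rightarrow> 'a::discrete_topology. \<forall>k<n. y k = a k}"
proof -
  have "{y. \<forall>k<n. y k = a k} = (\<Inter>k\<in>{..<n}. (\<lambda>y. y k) -` {a k})"
    by auto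
  also have "closed \<dots>"
    by (intro closed_INT ballI closed_vimage) (auto simp: closed_def intro: open_discrete)
  finally show ?thesis .
qed

text \<open>Successive approximation by points of a countable dense set: a step that is too long is
  ignored, so that every \<open>y\<close> describes a Cauchy sequence.\<close>

lemma Polish_space_Baire_image:
  assumes "Polish_space P" "topspace P \<noteq> {}"
  obtains f where "continuous_map Baire_space P f" "range f = topspace P"
proof -
  obtain M d where MS: "Metric_space M d" "Metric_space.mcomplete M d"
    and P: "P = Metric_space.mtopology M d"
    using assms(1) unfolding Polish_space_def completely_metrizable_space_def by blast
  interpret Metric_space M d by (fact MS(1))
  obtain C where C: "countable C" "C \<subseteq> M" "mtopology closure_of C = M"
    using assms(1) unfolding Polish_space_def separable_space_def P by auto
  then have Cne: "C \<noteq> {}" using assms(2) P by auto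
  define e where "e = from_nat_into C"
  have eM: "e n \<in> M" for n
    using from_nat_into[OF Cne, of n] C(2) by (auto simp: e_def)
  have dense: "\<exists>n. d (e n) x < r" if x: "x \<in> M" and r: "r > 0" for x r
  proof -
    have "x \<in> mtopology closure_of C" using C(3) x by simp
    then obtain c where "c \<in> C" "d x c < r"
      using r unfolding metric_closure_of by auto
    moreover obtain n where "e n = c"
      unfolding e_def using from_nat_into_surj[OF C(1) \<open>c \<in> C\<close>] by blast
    ultimately show ?thesis by (auto simp: commute)
  qed
  define p where "p y = rec_nat (e (y 0))
    (\<lambda>n q. if d q (e (y (Suc n))) \<le> (1/2)^n then e (y (Suc n)) else q)" for y :: "nat \<Rightarrow> nat"
  have p0: "p y 0 = e (y 0)"
    and pS: "p y (Suc n) = (if d (p y n) (e (y (Suc n))) \<le> (1/2)^n then e (y (Suc n)) else p y n)" for y n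
    by (simp_all add: p_def)
  have pM: "p y n \<in> M" for y n
    by (induction n) (auto simp: p0 pS eM)
  have step: "d (p y n) (p y (Suc n)) \<le> (1/2)^n" for y n
    using pM by (auto simp: pS)
  \<comment> \<open>The right side is the exact sum of the step bounds from \<open>n\<close> to
    \<open>n + k\<close>; in this form the induction goes through.\<close>
  have far: "d (p y n) (p y (n + k)) \<le> 2 * (1/2)^n - 2 * (1/2)^(n + k)" for y n k
  proof (induction k)
    case (Suc k)
    have "d (p y n) (p y (n + Suc k)) \<le> d (p y n) (p y (n + k)) + d (p y (n + k)) (p y (Suc (n + k)))"
      using triangle[OF pM pM pM] by simp
    also have "\<dots> \<le> (2 * (1/2)^n - 2 * (1/2)^(n + k)) + (1/2)^(n + k)"
      using Suc step by (intro add_mono)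
    finally show ?case by simp
  qed (use pM in simp)
  have far': "d (p y n) (p y m) \<le> 2 * (1/2)^n" if "n \<le> m" for y n m
    using far[of y n "m - n"] that by (simp add: le_add_diff_inverse)
      (smt (verit) zero_le_power divide_nonneg_nonneg)
  have small: "\<exists>n. 4 * (1/2::real)^n < \<epsilon>" if "\<epsilon> > 0" for \<epsilon>
    using real_arch_pow_inv[of "\<epsilon> / 4" "1/2"] that by (auto simp: field_simps)
  have "MCauchy (p y)" for y
    unfolding MCauchy_def
  proof (intro conjI allI impI)
    show "range (p y) \<subseteq> M" using pM by auto
    fix \<epsilon> :: real assume "\<epsilon> > 0"
    then obtain N where N: "4 * (1/2::real)^N < \<epsilon>" using small by blast
    have "d (p y n) (p y n') < \<epsilon>" if "N \<le> n" "N \<le> n'" for n n'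
      using triangle'[of "p y n" "p y N" "p y n'"] far'[OF that(1), of y] far'[OF that(2), of y] pM N
      by (smt (verit) commute triangle)
    then show "\<exists>N. \<forall>n n'. N \<le> n \<longrightarrow> N \<le> n' \<longrightarrow> d (p y n) (p y n') < \<epsilon>" by blast
  qed
  then have "\<exists>x. limitin mtopology (p y) x sequentially" for y
    using MS(2) unfolding mcomplete_def by blast
  then obtain L where L: "\<And>y. limitin mtopology (p y) (L y) sequentially"
    by metis
  have LM: "L y \<in> M" for y
    using L limitin_mspace by blast
  have pL: "d (p y n) (L y) \<le> 2 * (1/2)^n" for y n
  proof (rule field_le_epsilon)
    fix r :: real assume "r > 0"
    then obtain m where m: "\<And>k. k \<ge> m \<Longrightarrow> d (p y k) (L y) < r"
      using L[of y] unfolding limit_metric_sequentially by blast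
    have "d (p y n) (L y) \<le> d (p y n) (p y (n + m)) + d (p y (n + m)) (L y)"
      using triangle pM LM by blast
    then show "d (p y n) (L y) \<le> 2 * (1/2)^n + r"
      using far'[OF le_add1[of n m], of y] m[of "n + m"] by simp
  qed
  have cont: "continuous_map Baire_space mtopology L"
    unfolding continuous_map_def
  proof (intro conjI allI impI)
    show "L \<in> topspace Baire_space \<rightarrow> topspace mtopology" using LM by auto
    fix U assume U: "openin mtopology U"
    show "openin Baire_space {y \<in> topspace Baire_space. L y \<in> U}"
    proof (subst openin_subopen, intro ballI)
      fix y assume "y \<in> {y \<in> topspace Baire_space. L y \<in> U}"
      then obtain r where r: "r > 0" "mball (L y) r \<subseteq> U"
        using U by (auto simp: openin_mtopology)
      obtain n where n: "4 * (1/2::real)^n < r" using small[OF r(1)] by blast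
      \<comment> \<open>Sequences that agree up to index \<open>n\<close> have the same
        approximation \<open>p y n\<close>, and both limits lie within \<open>2 * (1/2)^n\<close> of
        it.\<close>
      have "L y' \<in> U" if y': "\<forall>k<Suc n. y' k = y k" for y'
      proof -
        have "p y' k = p y k" if "k \<le> n" for k
          using that by (induction k) (use y' in \<open>auto simp: p0 pS\<close>)
        then have "d (L y) (L y') \<le> d (p y n) (L y) + d (p y' n) (L y')"
          using triangle[of "L y" "p y n" "L y'"] LM pM by (simp add: commute)
        also have "\<dots> < r" using pL[of y n] pL[of y' n] n by simp
        finally show ?thesis using r(2) LM by auto
      qed
      then show "\<exists>T. openin Baire_space T \<and> y \<in> T \<and> T \<subseteq> {y \<in> topspace Baire_space. L y \<in> U}"
        using open_cylinder[of "Suc n" y]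
        by (intro exI[of _ "{y'. \<forall>k<Suc n. y' k = y k}"]) auto
    qed
  qed
  have "x \<in> range L" if x: "x \<in> M" for x
  proof -
    \<comment> \<open>With an error below a quarter of \<open>(1/2)^n\<close> no step is too long,
      so that none of the chosen points is ignored.\<close>
    have "\<forall>n. \<exists>m. d (e m) x < (1/2)^n / 4"
      by (intro allI dense[OF x]) simp
    then obtain y where y: "\<And>n. d (e (y n)) x < (1/2)^n / 4"
      by metis
    have "p y n = e (y n)" for n
    proof (induction n)
      case (Suc n)
      have "d (e (y n)) (e (y (Suc n))) \<le> d (e (y n)) x + d (e (y (Suc n))) x"
        using triangle[of "e (y n)" x "e (y (Suc n))"] eM x by (simp add: commute)
      also have "\<dots> \<le> (1/2)^n / 4 + (1/2)^Suc n / 4"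
        using y[of n] y[of "Suc n"] by simp
      also have "\<dots> \<le> (1/2)^n" by simp
      finally show ?case using Suc by (simp add: pS)
    qed (simp add: p0)
    then have "d x (L y) \<le> 4 * (1/2)^n" for n
    proof -
      have "d x (L y) \<le> d (e (y n)) x + d (p y n) (L y)"
        using triangle[of x "e (y n)" "L y"] x eM LM \<open>p y n = e (y n)\<close> by (simp add: commute)
      also have "\<dots> \<le> (1/2)^n / 4 + 2 * (1/2)^n"
        using y[of n] pL[of y n] by simp
      also have "\<dots> \<le> 4 * (1/2)^n" by simp
      finally show ?thesis .
    qed
    then have "\<not> d x (L y) > 0"
      using small[of "d x (L y)"] by (metis leD)
    then have "x = L y"
      using x LM by (metis mdist_pos_eq)
    then show ?thesis by simp
  qed
  with LM have "range L = M" by auto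
  with cont show thesis using that P by simp
qed

text \<open>Makes the types built from the Cantor space second countable, as
  \<open>base_sequence\<close> requires.\<close>

instance bool :: second_countable_topology
proof
  show "\<exists>B::bool set set. countable B \<and> open = generate_topology B"
  proof (intro exI conjI ext iffI)
    show "countable (UNIV :: bool set set)" by (simp add: countable_finite)
    show "generate_topology UNIV S" for S :: "bool set" by (simp add: generate_topology.Basis)
  qed (simp add: open_discrete)
qed

lemma completely_metrizable_discrete_sequences:
  "completely_metrizable_space (euclidean :: (nat \<Rightarrow> 'a::discrete_topology) topology)"
proof -
  have "completely_metrizable_space (euclidean :: 'a topology)"
    using completely_metrizable_space_discrete_topology[of "UNIV :: 'a set"]
    by (metis UNIV_I discrete_topology_unique open_discrete open_openin topspace_euclidean)
  then show ?thesis
    unfolding euclidean_product_topology[symmetric]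
    by (simp add: completely_metrizable_space_product_topology)
qed

lemma second_countable_euclidean:
  "second_countable (euclidean :: 'a::second_countable_topology topology)"
proof -
  obtain B :: "'a set set" where B: "countable B" "topological_basis B"
    using ex_countable_basis by blast
  have "\<exists>V\<in>B. x \<in> V \<and> V \<subseteq> U" if "open U" "x \<in> U" for U x
    by (rule topological_basisE[OF B(2) that]) blast
  then show ?thesis
    unfolding second_countable_def
    using B(1) topological_basis_open[OF B(2)] by (intro exI[of _ B]) auto
qed

lemma completely_metrizable_Cantor_real:
  "completely_metrizable_space (euclidean :: ((nat \<Rightarrow> bool) \<times> real) topology)"
  unfolding prod_topology_euclidean[symmetric]
  by (simp only: completely_metrizable_space_prod_topology completely_metrizable_discrete_sequences
      completely_metrizable_space_euclidean simp_thms)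

lemma Polish_space_Cantor_real: "Polish_space (euclidean :: ((nat \<Rightarrow> bool) \<times> real) topology)"
  unfolding Polish_space_def
  by (simp add: completely_metrizable_Cantor_real second_countable_imp_separable_space second_countable_euclidean)

text \<open>The closed set \<open>C\<close> above \<open>X\<close> is itself Polish, hence a
  continuous image of the Baire space; the projection carries it onto \<open>X\<close>.\<close>

lemma analytic_Baire_image:
  fixes X :: "((nat \<Rightarrow> bool) \<times> real) set"
  assumes "analytic_in euclidean X" "X \<noteq> {}"
  obtains f :: "(nat \<Rightarrow> nat) \<Rightarrow> (nat \<Rightarrow> bool) \<times> real"
  where "continuous_on UNIV f" "range f = X"
proof -
  obtain C :: "(((nat \<Rightarrow> bool) \<times> real) \<times> (nat \<Rightarrow> nat)) set"
    where C: "closed C" "X = fst ` C"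
    using assms(1) unfolding analytic_in_def by auto
  have "completely_metrizable_space (euclidean :: (((nat \<Rightarrow> bool) \<times> real) \<times> (nat \<Rightarrow> nat)) topology)"
    unfolding prod_topology_euclidean[symmetric, where ?'a = "(nat \<Rightarrow> bool) \<times> real"]
    by (simp only: completely_metrizable_space_prod_topology completely_metrizable_Cantor_real
      completely_metrizable_discrete_sequences simp_thms)
  then have "completely_metrizable_space (top_of_set C)"
    using C(1) by (intro completely_metrizable_space_closedin) auto
  moreover have "separable_space (top_of_set C)"
    by (intro second_countable_imp_separable_space second_countable_subtopology second_countable_euclidean)
  ultimately have "Polish_space (top_of_set C)" by (simp add: Polish_space_def)
  moreover have "topspace (top_of_set C) \<noteq> {}" using assms(2) C(2) by auto
  ultimately obtain f where f: "continuous_map Baire_space (top_of_set C) f" "range f = C"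
    by (metis Polish_space_Baire_image topspace_euclidean_subtopology)
  have "continuous_on UNIV (\<lambda>y. fst (f y))"
    using f(1) by (intro continuous_on_fst) (simp add: continuous_map_in_subtopology)
  moreover have "range (\<lambda>y. fst (f y)) = X"
    using f(2) C(2) by auto
  ultimately show thesis using that by blast
qed

text \<open>The predicate \<open>u\<close> is a point of the Cantor space, so that such points can
  serve as codes of open sets.\<close>

lemma base_sequence:
  "\<exists>b :: nat \<Rightarrow> 'a::second_countable_topology set.
    (\<forall>n. open (b n)) \<and> (\<forall>U. open U \<longrightarrow> (\<exists>u. U = (\<Union>n\<in>Collect u. b n)))"
proof -
  obtain B :: "'a set set" where B: "countable B" "topological_basis B"
    using ex_countable_basis by blast
  have "B \<noteq> {}"
    using topological_basisE[OF B(2), of UNIV undefined] by auto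
  define b where "b = from_nat_into B"
  have r: "range b = B"
    unfolding b_def using B(1) \<open>B \<noteq> {}\<close> by (intro range_from_nat_into)
  show ?thesis
  proof (intro exI[of _ b] conjI allI impI)
    show "open (b n)" for n
      using topological_basis_open[OF B(2)] r by blast
    fix U :: "'a set" assume "open U"
    then obtain B' where B': "B' \<subseteq> B" "\<Union>B' = U"
      using B(2) unfolding topological_basis_def by auto
    have "U = (\<Union>n\<in>Collect (\<lambda>n. b n \<in> B'). b n)"
      unfolding B'(2)[symmetric]
    proof (intro subset_antisym subsetI)
      fix x assume "x \<in> \<Union>B'"
      then obtain V where "V \<in> B'" "x \<in> V" by blast
      moreover obtain n where "V = b n" using r B'(1) \<open>V \<in> B'\<close> by blast
      ultimately show "x \<in> (\<Union>n\<in>Collect (\<lambda>n. b n \<in> B'). b n)" by blast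
    qed auto
    then show "\<exists>u. U = (\<Union>n\<in>Collect u. b n)" by (rule exI[of _ "\<lambda>n. b n \<in> B'"])
  qed
qed

section \<open>A continuous injection of the Baire space into the reals\<close>

definition ternary :: "(nat \<Rightarrow> bool) \<Rightarrow> real" where
  "ternary c = (\<Sum>k. of_bool (c k) * (1/3)^k)"

lemma summable_ternary: "summable (\<lambda>k. of_bool (c k) * (1/3::real)^k)"
  by (rule summable_comparison_test'[OF summable_geometric[of "1/3 :: real"], of 0]) auto

lemma continuous_on_ternary: "continuous_on UNIV ternary"
proof -
  have "uniform_limit UNIV (\<lambda>n c. \<Sum>k<n. of_bool (c k) * (1/3::real)^k) ternary sequentially"
    unfolding ternary_def
    by (rule Weierstrass_m_test[where M = "\<lambda>k. (1/3)^k"]) (auto intro: summable_geometric)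
  moreover have "continuous_on UNIV (\<lambda>c::nat \<Rightarrow> bool. \<Sum>k<n. of_bool (c k) * (1/3::real)^k)" for n
  proof -
    have "continuous_on UNIV (\<lambda>c::nat \<Rightarrow> bool. of_bool (c k) :: real)" for k
      by (rule continuous_on_compose2[of UNIV of_bool])
        (auto simp: continuous_on_open_vimage intro: open_discrete)
    then show ?thesis by (intro continuous_intros)
  qed
  ultimately show ?thesis
    by (intro uniform_limit_theorem) auto
qed

text \<open>With digits \<open>0\<close> and \<open>1\<close> in base \<open>3\<close>, the tail
  after position \<open>n\<close> is at most half of \<open>(1/3)^n\<close>, so the first difference
  decides.\<close>

lemma ternary_less:
  assumes "c n" "\<not> c' n" "\<And>k. k < n \<Longrightarrow> c k = c' k"
  shows "ternary c' < ternary c"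
proof -
  define f where "f k = of_bool (c k) * (1/3::real)^k" for k
  define g where "g k = of_bool (c' k) * (1/3::real)^k" for k
  have sf: "summable f" "summable g"
    unfolding f_def g_def by (rule summable_ternary)+
  have "(\<Sum>k. g (k + Suc n)) \<le> (\<Sum>k. (1/3)^Suc n * (1/3)^k)"
  proof (rule suminf_le)
    show "g (k + Suc n) \<le> (1/3)^Suc n * (1/3)^k" for k
      by (simp add: g_def power_add)
    show "summable (\<lambda>k. g (k + Suc n))"
      using sf(2) by (rule summable_ignore_initial_segment)
    show "summable (\<lambda>k. (1/3::real)^Suc n * (1/3)^k)"
      by (intro summable_mult summable_geometric) simp
  qed
  also have "\<dots> = (1/3)^Suc n * (3/2)"
    by (subst suminf_mult) (simp_all add: suminf_geometric summable_geometric)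
  also have "\<dots> < (1/3::real)^n" by simp
  finally have g: "(\<Sum>k. g (k + Suc n)) < (1/3)^n" .
  have f: "0 \<le> (\<Sum>k. f (k + Suc n))"
    by (rule suminf_nonneg[OF summable_ignore_initial_segment[OF sf(1)]]) (simp add: f_def)
  have "sum g {..<Suc n} + (1/3)^n = sum f {..<Suc n}"
    using assms by (simp add: f_def g_def)
  with f g show ?thesis
    using suminf_split_initial_segment[OF sf(1), of "Suc n"]
      suminf_split_initial_segment[OF sf(2), of "Suc n"]
    unfolding ternary_def f_def[symmetric] g_def[symmetric] by linarith
qed

lemma inj_ternary: "inj ternary"
proof (rule injI, rule ccontr)
  fix c c' assume eq: "ternary c = ternary c'" and "c \<noteq> c'"
  then obtain n where n: "c n \<noteq> c' n" "\<And>k. k < n \<Longrightarrow> c k = c' k"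
    using exists_least_iff[of "\<lambda>n. c n \<noteq> c' n"] by blast
  then show False
    using ternary_less[of c n c'] ternary_less[of c' n c] eq by (cases "c n") auto
qed

text \<open>The characteristic function of the graph of \<open>y\<close>, with pairs coded as
  numbers. It carries the Baire space continuously and injectively into the Cantor space.\<close>

definition graph_code :: "(nat \<Rightarrow> nat) \<Rightarrow> nat \<Rightarrow> bool" where
  "graph_code y k = (case prod_decode k of (n, m) \<Rightarrow> y n = m)"

lemma continuous_on_graph_code: "continuous_on UNIV graph_code"
proof (rule continuous_on_coordinatewise_then_product)
  fix k
  have "continuous_on UNIV (\<lambda>y::nat \<Rightarrow> nat. y (fst (prod_decode k)) = snd (prod_decode k))"
    by (rule continuous_on_compose2[of UNIV "\<lambda>i. i = snd (prod_decode k)"])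
      (auto simp: continuous_on_open_vimage intro: open_discrete)
  then show "continuous_on UNIV (\<lambda>y. graph_code y k)"
    by (simp add: graph_code_def case_prod_beta)
qed

lemma inj_graph_code: "inj graph_code"
proof (rule injI, rule ext)
  fix y y' n assume "graph_code y = graph_code y'"
  then have "graph_code y (prod_encode (n, y n)) = graph_code y' (prod_encode (n, y n))" by simp
  then show "y n = y' n" by (simp add: graph_code_def)
qed

text \<open>A relation fails to be the graph of a function because some row is empty or some row has
  two entries. The sets on the right are closed, and there are countably many of them.\<close>

lemma Compl_range_graph_code:
  "- range graph_code = (\<Union>n. {c. \<forall>m. \<not> c (prod_encode (n, m))}) \<union>
    (\<Union>n. \<Union>m. \<Union>m'. {c. m \<noteq> m' \<and> c (prod_encode (n, m)) \<and> c (prod_encode (n, m'))})"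
  (is "_ = ?R")
proof (intro subset_antisym subsetI)
  fix c assume "c \<in> ?R"
  then show "c \<in> - range graph_code"
    by (auto simp: graph_code_def)
next
  fix c assume c: "c \<in> - range graph_code"
  show "c \<in> ?R"
  proof (rule ccontr)
    assume "c \<notin> ?R"
    then have "\<forall>n. \<exists>m. c (prod_encode (n, m))"
      and *: "\<And>n m m'. c (prod_encode (n, m)) \<Longrightarrow> c (prod_encode (n, m')) \<Longrightarrow> m = m'"
      by auto
    then obtain y where y: "\<And>n. c (prod_encode (n, y n))" by metis
    have "c = graph_code y"
    proof
      fix k
      show "c k = graph_code y k"
      proof (cases "prod_decode k")
        case (Pair n m)
        then have "k = prod_encode (n, m)" by (metis prod_decode_inverse)
        then show ?thesis
          using y[of n] *[of n "y n" m] by (auto simp: graph_code_def)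
      qed
    qed
    with c show False by blast
  qed
qed

definition Baire_real :: "(nat \<Rightarrow> nat) \<Rightarrow> real" where
  "Baire_real y = ternary (graph_code y)"

lemma continuous_on_Baire_real: "continuous_on UNIV Baire_real"
  unfolding Baire_real_def
  by (rule continuous_on_compose2[OF continuous_on_ternary continuous_on_graph_code]) simp

lemma inj_Baire_real: "inj Baire_real"
  using inj_compose[OF inj_ternary inj_graph_code] by (simp add: Baire_real_def[abs_def] o_def)

lemma compact_UNIV_Cantor: "compact (UNIV :: (nat \<Rightarrow> bool) set)"
proof -
  have "compact_space (product_topology (\<lambda>n::nat. euclidean :: bool topology) UNIV)"
    unfolding compact_space_product_topology
    by (auto simp: compact_space_def finite_imp_compact)
  then show ?thesis
    by (simp add: euclidean_product_topology compact_space_def)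
qed

text \<open>A real outside the range either avoids the compact set \<open>range ternary\<close> or
  is \<open>ternary c\<close> with \<open>c\<close> not a graph. The latter reals form a countable
  union of compact sets, since closed subsets of the Cantor space have compact images.\<close>

lemma analytic_Compl_range_Baire_real: "analytic_in euclidean (- range Baire_real)"
proof -
  have cl: "analytic_in euclidean (ternary ` S)" if "closed S" for S
  proof -
    have "compact (UNIV \<inter> S)" using compact_UNIV_Cantor that by (rule compact_Int_closed)
    then have "compact (ternary ` S)"
      by (intro compact_continuous_image continuous_on_subset[OF continuous_on_ternary]) auto
    then show ?thesis by (intro analytic_in_closedin) (simp add: compact_imp_closed)
  qed
  have "closed {c::nat \<Rightarrow> bool. c k}" "closed {c::nat \<Rightarrow> bool. \<not> c k}" for k
  proof -
    have "{c::nat \<Rightarrow> bool. c k} = (\<lambda>c. c k) -` {True}" "{c::nat \<Rightarrow> bool. \<not> c k} = (\<lambda>c. c k) -` {False}"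
      by auto
    moreover have "closed ((\<lambda>c::nat \<Rightarrow> bool. c k) -` {b})" for b
      by (intro closed_vimage) (auto simp: closed_def intro: open_discrete)
    ultimately show "closed {c::nat \<Rightarrow> bool. c k}" "closed {c::nat \<Rightarrow> bool. \<not> c k}" by simp_all
  qed
  then have "analytic_in euclidean (ternary ` {c. \<forall>m. \<not> c (prod_encode (n, m))})"
    "analytic_in euclidean (ternary ` {c. m \<noteq> m' \<and> c (prod_encode (n, m)) \<and> c (prod_encode (n, m'))})"
    for n m m'
    by (intro cl closed_Collect_all closed_Collect_conj closed_Collect_const; simp)+
  then have "analytic_in euclidean (ternary ` (- range graph_code))"
    unfolding Compl_range_graph_code image_Un image_UN
    by (intro analytic_in_Un analytic_in_UN)
  moreover have "analytic_in euclidean (- range ternary)"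
  proof -
    have "compact (range ternary)"
      using continuous_on_ternary compact_UNIV_Cantor by (rule compact_continuous_image)
    then have "open (- range ternary)" by (simp add: compact_imp_closed open_Compl)
    then show ?thesis
      by (intro analytic_in_openin) (auto simp: metrizable_space_euclidean)
  qed
  moreover have "- range Baire_real = - range ternary \<union> ternary ` (- range graph_code)"
    using inj_ternary unfolding Baire_real_def by (auto simp: inj_def)
  ultimately show ?thesis by (simp add: analytic_in_Un)
qed

section \<open>A closed set from which every \<Sigma>12 subset of the Cantor space can be read
  off\<close>

definition cantor_baire_base :: "nat \<Rightarrow> (((nat \<Rightarrow> bool) \<times> (nat \<Rightarrow> nat)) \<times> (nat \<Rightarrow> nat)) set" where
  "cantor_baire_base = (SOME b. (\<forall>n. open (b n)) \<and> (\<forall>U. open U \<longrightarrow> (\<exists>u. U = (\<Union>n\<in>Collect u. b n))))"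

lemma cantor_baire_base:
  shows open_cantor_baire_base: "open (cantor_baire_base n)"
    and cantor_baire_base_union: "open U \<Longrightarrow> \<exists>u. U = (\<Union>n\<in>Collect u. cantor_baire_base n)"
proof -
  have "(\<forall>n. open (cantor_baire_base n)) \<and>
      (\<forall>U. open U \<longrightarrow> (\<exists>u. U = (\<Union>n\<in>Collect u. cantor_baire_base n)))"
    unfolding cantor_baire_base_def by (rule someI_ex[OF base_sequence])
  then show "open (cantor_baire_base n)" "open U \<Longrightarrow> \<exists>u. U = (\<Union>n\<in>Collect u. cantor_baire_base n)"
    by auto
qed

text \<open>The coordinates \<open>x (3 * n)\<close> choose which basic open sets are removed and the coordinates
  \<open>x (3 * n + 1)\<close> hold the point at which the resulting \<open>\<Sigma>\<^sup>1\<^sub>2\<close> set is tested; the coordinates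
  \<open>x (3 * n + 2)\<close> are kept free, so that the sequences vanishing there form a nowhere dense set.\<close>

definition universal_closed :: "(((nat \<Rightarrow> bool) \<times> (nat \<Rightarrow> nat)) \<times> (nat \<Rightarrow> nat)) set" where
  "universal_closed = {((x, y), z). \<forall>n. x (3 * n) \<longrightarrow> ((\<lambda>k. x (3 * k + 1), y), z) \<notin> cantor_baire_base n}"

lemma closed_universal_closed: "closed universal_closed"
proof -
  define g :: "((nat \<Rightarrow> bool) \<times> (nat \<Rightarrow> nat)) \<times> (nat \<Rightarrow> nat) \<Rightarrow> _"
    where "g = (\<lambda>((x, y), z). ((\<lambda>k. x (3 * k + 1), y), z))"
  have coord: "continuous_on UNIV (\<lambda>u::((nat \<Rightarrow> bool) \<times> (nat \<Rightarrow> nat)) \<times> (nat \<Rightarrow> nat). fst (fst u) k)" for k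
    by (rule continuous_on_product_then_coordinatewise)
      (intro continuous_on_fst continuous_on_id)
  have "continuous_on UNIV g"
    unfolding g_def case_prod_beta
    by (intro continuous_on_Pair continuous_on_coordinatewise_then_product coord continuous_on_fst
        continuous_on_snd continuous_on_id)
  then have cl: "closed ({u. \<not> fst (fst u) (3 * n)} \<union> - (g -` cantor_baire_base n))" for n
  proof (intro closed_Un closed_Compl open_vimage open_cantor_baire_base)
    have "{u. \<not> fst (fst u) (3 * n)} =
      (\<lambda>u::((nat \<Rightarrow> bool) \<times> (nat \<Rightarrow> nat)) \<times> (nat \<Rightarrow> nat). fst (fst u) (3 * n)) -` {False}"
      by auto
    moreover have "closed \<dots>"
      by (intro closed_vimage coord) (simp add: closed_def open_discrete)
    ultimately show "closed {u::((nat \<Rightarrow> bool) \<times> (nat \<Rightarrow> nat)) \<times> (nat \<Rightarrow> nat). \<not> fst (fst u) (3 * n)}"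
      by simp
  qed auto
  have eq: "universal_closed = (\<Inter>n. {u. \<not> fst (fst u) (3 * n)} \<union> - (g -` cantor_baire_base n))"
    by (auto simp: universal_closed_def g_def)
  show ?thesis unfolding eq by (intro closed_INT ballI cl)
qed

text \<open>Write the complement of the coanalytic set \<open>B\<close> as the projection of a
  closed set \<open>C\<close>. The code \<open>u\<close> lists the basic open sets whose union is
  the complement of \<open>C\<close>.\<close>

lemma Sigma12_universal:
  assumes "Sigma12_in Cantor_space A"
  obtains u :: "nat \<Rightarrow> bool" where "\<And>x. (\<And>n. x (3 * n) = u n) \<Longrightarrow>
    (\<lambda>n. x (3 * n + 1)) \<in> A \<longleftrightarrow> (\<exists>y. \<forall>z. ((x, y), z) \<notin> universal_closed)"
proof -
  obtain B where B: "coanalytic_in euclidean B" "A = fst ` (B :: ((nat \<Rightarrow> bool) \<times> (nat \<Rightarrow> nat)) set)"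
    using assms unfolding Sigma12_in_def by auto
  obtain C where C: "closed C"
    "- B = fst ` (C :: (((nat \<Rightarrow> bool) \<times> (nat \<Rightarrow> nat)) \<times> (nat \<Rightarrow> nat)) set)"
    using B(1) unfolding coanalytic_in_def analytic_in_def by (auto simp: Compl_eq_Diff_UNIV)
  obtain u where u: "- C = (\<Union>n\<in>Collect u. cantor_baire_base n)"
    using cantor_baire_base_union[of "- C"] C(1) by auto
  show thesis
  proof (rule that[of u])
    fix x :: "nat \<Rightarrow> bool" assume x: "\<And>n. x (3 * n) = u n"
    define a where "a = (\<lambda>n. x (3 * n + 1))"
    have "((x, y), z) \<notin> universal_closed \<longleftrightarrow> ((a, y), z) \<in> - C" for y z
      unfolding u by (auto simp: universal_closed_def x a_def)
    then have "(\<exists>y. \<forall>z. ((x, y), z) \<notin> universal_closed) \<longleftrightarrow> (\<exists>y. (a, y) \<notin> fst ` C)"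
      by force
    also have "\<dots> \<longleftrightarrow> a \<in> A"
      unfolding B(2) C(2)[symmetric] by force
    finally show "a \<in> A \<longleftrightarrow> (\<exists>y. \<forall>z. ((x, y), z) \<notin> universal_closed)" by simp
  qed
qed

section \<open>The space and its fibres\<close>

definition sparse_seqs :: "(nat \<Rightarrow> bool) set" where
  "sparse_seqs = {x. \<forall>n. \<not> x (3 * n + 2)}"

text \<open>As \<open>Baire_real\<close> is injective, the points missing over \<open>x\<close> are
  the values \<open>Baire_real y\<close> with
  \<open>\<forall>z. ((x, y), z) \<notin> universal_closed\<close>. The positive form with
  existential quantifiers shows that the set is analytic.\<close>

definition base_fibres :: "((nat \<Rightarrow> bool) \<times> real) set" where
  "base_fibres = {(x, t). t \<in> range Baire_real \<longrightarrow> (\<exists>y z. t = Baire_real y \<and> ((x, y), z) \<in> universal_closed)}"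

text \<open>Over \<open>x \<in> sparse_seqs\<close> the points missing from the fibre are those of a set invariant under
  rational translations, so they are either none or dense in \<open>[0,1]\<close>.\<close>

definition X_infinity :: "((nat \<Rightarrow> bool) \<times> real) set" where
  "X_infinity = {(x, t). 0 \<le> t \<and> t \<le> 1 \<and>
     (x \<in> sparse_seqs \<longrightarrow> (\<forall>q. (x, t - real_of_rat q) \<in> base_fibres))}"

lemma cylinder_subset_open:
  fixes U :: "(nat \<Rightarrow> 'a::topological_space) set"
  assumes "open U" "x \<in> U"
  obtains n where "{x'. \<forall>k<n. x' k = x k} \<subseteq> U"
proof -
  have "openin (product_topology (\<lambda>n::nat. euclidean :: 'a topology) UNIV) U"
    using assms(1) by (simp add: euclidean_product_topology)
  from product_topology_open_contains_basis[OF this assms(2)]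
  obtain V where V: "x \<in> Pi\<^sub>E UNIV V" "finite {i. V i \<noteq> UNIV}" "Pi\<^sub>E UNIV V \<subseteq> U"
    by auto
  obtain n where n: "\<And>i. V i \<noteq> UNIV \<Longrightarrow> i < n"
    using V(2) unfolding finite_nat_set_iff_bounded by blast
  have "x' \<in> U" if x': "\<forall>k<n. x' k = x k" for x'
  proof -
    have "x' i \<in> V i" for i
      using n[of i] x' V(1) by (cases "V i = UNIV") (auto simp: PiE_iff)
    then show ?thesis using V(3) by (auto simp: PiE_iff)
  qed
  then show thesis using that by blast
qed

lemma closed_sparse_seqs: "closed sparse_seqs"
proof -
  have eq: "sparse_seqs = (\<Inter>n. (\<lambda>x::nat \<Rightarrow> bool. x (3 * n + 2)) -` {False})"
    by (auto simp: sparse_seqs_def)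
  show ?thesis
    unfolding eq
    by (intro closed_INT ballI closed_vimage) (auto simp: closed_def intro: open_discrete)
qed

lemma metrizable_Cantor_real: "metrizable_space (euclidean :: ((nat \<Rightarrow> bool) \<times> real) topology)"
  by (rule completely_metrizable_imp_metrizable_space[OF completely_metrizable_Cantor_real])

lemma finite_closed_Cantor_real:
  fixes S :: "((nat \<Rightarrow> bool) \<times> real) set"
  assumes "finite S" shows "closed S"
  using assms metrizable_imp_t1_space[OF metrizable_Cantor_real]
  by (simp add: t1_space_closedin_finite)

text \<open>The quantifiers over \<open>y\<close> and \<open>z\<close> are projections of the closed
  set \<open>?E\<close> along the Baire space; the other points lie over the complement of
  \<open>range Baire_real\<close>.\<close>

lemma analytic_base_fibres: "analytic_in euclidean base_fibres"
proof -
  let ?A = "{p::(nat \<Rightarrow> bool) \<times> real. snd p \<in> - range Baire_real}"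
  let ?E = "{(((x, t), y), z). t = Baire_real y \<and> ((x, y), z) \<in> universal_closed}"
  have "analytic_in euclidean {p \<in> topspace (euclidean :: ((nat \<Rightarrow> bool) \<times> real) topology). snd p \<in> - range Baire_real}"
    by (rule analytic_in_preimage[OF analytic_Compl_range_Baire_real])
      (simp add: continuous_on_snd continuous_on_id)
  then have 1: "analytic_in euclidean ?A" by simp
  have "?E = {p. snd (fst (fst p)) = Baire_real (snd (fst p))} \<inter>
      (\<lambda>p. ((fst (fst (fst p)), snd (fst p)), snd p)) -` universal_closed"
    by auto
  moreover have "closed \<dots>"
    by (intro closed_Int closed_Collect_eq closed_vimage closed_universal_closed
        continuous_on_compose2[OF continuous_on_Baire_real] continuous_intros) auto
  ultimately have "closed ?E" by simp
  then have "analytic_in (prod_topology (prod_topology euclidean Baire_space) Baire_space) ?E"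
    by (intro analytic_in_closedin) simp
  then have "analytic_in euclidean (fst ` fst ` ?E)"
    by (intro analytic_in_projection)
  moreover have eq: "base_fibres = ?A \<union> fst ` fst ` ?E"
  proof -
    have "p \<in> fst ` fst ` ?E \<longleftrightarrow>
        (\<exists>y z. snd p = Baire_real y \<and> ((fst p, y), z) \<in> universal_closed)" for p
      by (cases p) (auto simp: image_image image_iff Bex_def)
    then show ?thesis
      unfolding base_fibres_def by (intro set_eqI) (simp add: case_prod_beta; blast)
  qed
  ultimately show ?thesis unfolding eq by (intro analytic_in_Un 1)
qed

lemma analytic_X_infinity: "analytic_in euclidean X_infinity"
proof -
  have "closed (UNIV \<times> {0..1} :: ((nat \<Rightarrow> bool) \<times> real) set)"
    by (intro closed_Times) auto
  then have 1: "analytic_in euclidean (UNIV \<times> {0..1} :: ((nat \<Rightarrow> bool) \<times> real) set)"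
    by (intro analytic_in_closedin) simp
  have "open ((- sparse_seqs) \<times> (UNIV :: real set))"
    by (intro open_Times open_Compl closed_sparse_seqs) auto
  then have 2: "analytic_in euclidean ((- sparse_seqs) \<times> (UNIV :: real set))"
    by (intro analytic_in_openin metrizable_Cantor_real) simp
  have 3: "analytic_in euclidean {p. (fst p, snd p - real_of_rat q) \<in> base_fibres}" for q
  proof -
    have "analytic_in euclidean {p \<in> topspace (euclidean :: ((nat \<Rightarrow> bool) \<times> real) topology).
        (fst p, snd p - real_of_rat q) \<in> base_fibres}"
      by (rule analytic_in_preimage[OF analytic_base_fibres]) (simp add: continuous_intros)
    then show ?thesis by simp
  qed
  \<comment> \<open>The rationals are enumerated to turn the quantifier into an intersection indexed
    by natural numbers.\<close>
  have all_rat: "(\<forall>q. Q q) \<longleftrightarrow> (\<forall>n. Q (from_nat n))" for Q :: "rat \<Rightarrow> bool"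
    by (metis from_nat_to_nat)
  have eq: "X_infinity = (UNIV \<times> {0..1}) \<inter> ((- sparse_seqs) \<times> UNIV \<union>
      (\<Inter>n::nat. {p. (fst p, snd p - real_of_rat (from_nat n)) \<in> base_fibres}))"
    unfolding X_infinity_def all_rat by auto
  show ?thesis
    unfolding eq by (intro analytic_in_Un analytic_in_Int analytic_in_INT 1 2 3)
qed

section \<open>Fibres enlarged by finite sets of outer points\<close>

definition outer_points :: "nat \<Rightarrow> (nat \<Rightarrow> bool) \<Rightarrow> ((nat \<Rightarrow> bool) \<times> real) set" where
  "outer_points n x = {(x', t). 0 \<le> t \<and> t \<le> 1 \<and> x' \<notin> sparse_seqs \<and> (\<forall>k<n. x' k = x k)}"

lemma outer_points_subset: "outer_points n x \<subseteq> X_infinity"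
  by (auto simp: outer_points_def X_infinity_def)

text \<open>Makes the nets chosen from these sets locally constant in \<open>x\<close>.\<close>

lemma outer_points_cong: "(\<And>k. k < n \<Longrightarrow> x k = x' k) \<Longrightarrow> outer_points n x = outer_points n x'"
  by (auto simp: outer_points_def)

lemma outer_points_mono: "m \<le> n \<Longrightarrow> outer_points n x \<subseteq> outer_points m x"
  by (auto simp: outer_points_def)

text \<open>The fibre alone need not depend continuously on \<open>x\<close> in a given admissible topology. Finite sets
  \<open>E n\<close> of points outside \<open>sparse_seqs\<close> are added to it; they become isolated points and do not
  affect zero-dimensionality.\<close>

definition fibre_with :: "(nat \<Rightarrow> bool) \<Rightarrow> (nat \<Rightarrow> ((nat \<Rightarrow> bool) \<times> real) set) \<Rightarrow> ((nat \<Rightarrow> bool) \<times> real) set" where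
  "fibre_with x E = X_infinity \<inter> ({x} \<times> UNIV) \<union> (\<Union>n. E n)"

context
  fixes x :: "nat \<Rightarrow> bool" and E :: "nat \<Rightarrow> ((nat \<Rightarrow> bool) \<times> real) set"
  assumes x: "x \<in> sparse_seqs" and finE: "\<And>n. finite (E n)" and E: "\<And>n. E n \<subseteq> outer_points n x"
begin

lemma fibre_with_subset: "fibre_with x E \<subseteq> X_infinity"
  using E outer_points_subset by (fastforce simp: fibre_with_def)

text \<open>If \<open>fst p\<close> differs from \<open>x\<close> at \<open>m\<close>, then a point
  of the set whose first coordinate agrees with \<open>fst p\<close> up to \<open>m\<close> lies in
  some \<open>E n\<close> with \<open>n \<le> m\<close>; these are finitely many. As
  \<open>p\<close> itself may lie outside the set, this also yields closedness.\<close>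

lemma fibre_with_isolated:
  assumes "fst p \<noteq> x"
  obtains U where "open U" "p \<in> U" "U \<inter> fibre_with x E \<subseteq> {p}"
proof -
  obtain m where m: "fst p m \<noteq> x m" using assms by blast
  let ?C = "{x'. \<forall>k<Suc m. x' k = fst p k} \<times> (UNIV :: real set)"
  let ?F = "(\<Union>n\<in>{..m}. E n) - {p}"
  have "finite ?F" using finE by simp
  then have "open (?C - ?F)"
    by (intro open_Diff open_Times open_cylinder open_UNIV finite_closed_Cantor_real)
  moreover have "p \<in> ?C - ?F" by (cases p) auto
  moreover have "(?C - ?F) \<inter> fibre_with x E \<subseteq> {p}"
  proof
    fix r assume r: "r \<in> (?C - ?F) \<inter> fibre_with x E"
    then have rm: "fst r m = fst p m" by auto
    with r m obtain n where n: "r \<in> E n" by (auto simp: fibre_with_def)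
    have "n \<le> m"
    proof (rule ccontr)
      assume "\<not> n \<le> m"
      then have "fst r m = x m"
        using n E[of n] by (auto simp: outer_points_def)
      with rm m show False by simp
    qed
    with n r show "r \<in> {p}" by auto
  qed
  ultimately show thesis using that by blast
qed

lemma closedin_fibre_with: "closedin (top_of_set X_infinity) (fibre_with x E)"
proof -
  have "p \<in> fibre_with x E" if p: "p \<in> X_infinity" "p \<in> closure (fibre_with x E)" for p
  proof (cases "fst p = x")
    case True
    with p(1) show ?thesis by (cases p) (auto simp: fibre_with_def)
  next
    case False
    then obtain U where U: "open U" "p \<in> U" "U \<inter> fibre_with x E \<subseteq> {p}"
      by (rule fibre_with_isolated)
    then have "U \<inter> fibre_with x E \<noteq> {}"
      using p(2) by (metis IntI empty_iff open_Int_closure_eq_empty)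
    with U(3) show ?thesis by auto
  qed
  then have "fibre_with x E = X_infinity \<inter> closure (fibre_with x E)"
    using fibre_with_subset closure_subset by fastforce
  then show ?thesis by (metis closed_closure closedin_closed_Int)
qed

text \<open>The point \<open>Baire_real y\<close> is missing from \<open>base_fibres\<close>, so all
  its rational translates are missing from the fibre. The gap may fall outside \<open>[0,1]\<close>,
  which takes care of neighbourhoods of the end points.\<close>

lemma fibre_gaps:
  assumes y: "\<forall>z. ((x, y), z) \<notin> universal_closed" and ab: "a < b"
  obtains t where "a < t" "t < b" "(x, t) \<notin> X_infinity"
proof -
  obtain q where q: "a - Baire_real y < real_of_rat q" "real_of_rat q < b - Baire_real y"
    using of_rat_dense[of "a - Baire_real y" "b - Baire_real y"] ab by auto
  have "(x, Baire_real y) \<notin> base_fibres"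
    using y inj_Baire_real by (auto simp: base_fibres_def inj_eq)
  then have "(x, Baire_real y + real_of_rat q - real_of_rat q) \<notin> base_fibres" by simp
  then have "(x, Baire_real y + real_of_rat q) \<notin> X_infinity"
    using x unfolding X_infinity_def by blast
  with q show thesis by (intro that[of "Baire_real y + real_of_rat q"]) auto
qed

text \<open>Points off the fibre are isolated. A point of the fibre has small clopen neighbourhoods:
  boxes whose lower and upper edges are put at gaps of the fibre.\<close>

lemma zero_dimensional_fibre_with_if:
  assumes y: "\<forall>z. ((x, y), z) \<notin> universal_closed"
  shows "zero_dimensional (top_of_set (fibre_with x E))"
proof -
  let ?G = "fibre_with x E"
  have "\<exists>V. openin (top_of_set ?G) V \<and> closedin (top_of_set ?G) V \<and> p \<in> V \<and> V \<subseteq> U'"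
    if U': "openin (top_of_set ?G) U'" "p \<in> U'" for U' p
  proof -
    obtain W where W: "open W" "U' = ?G \<inter> W"
      using U'(1) by (auto simp: openin_open)
    have p: "p \<in> ?G" "p \<in> W" using U'(2) W(2) by auto
    show ?thesis
    proof (cases "fst p = x")
      case False
      then obtain U where "open U" "p \<in> U" "U \<inter> ?G \<subseteq> {p}"
        by (rule fibre_with_isolated)
      then have "openin (top_of_set ?G) {p}"
        using p(1) by (auto simp: openin_open)
      moreover have "closedin (top_of_set ?G) {p}"
        using p(1) finite_closed_Cantor_real[of "{p}"] by (auto simp: closedin_closed intro!: exI[of _ "{p}"])
      ultimately show ?thesis using p W(2) by (intro exI[of _ "{p}"]) auto
    next
      case True
      obtain A B where AB: "open A" "open B" "p \<in> A \<times> B" "A \<times> B \<subseteq> W"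
        using open_prod_elim[OF W(1) p(2)] by metis
      have "x \<in> A" using AB(3) True by auto
      then obtain n where n: "{x'. \<forall>k<n. x' k = x k} \<subseteq> A"
        by (rule cylinder_subset_open[OF AB(1)])
      obtain e where e: "e > 0" "ball (snd p) e \<subseteq> B"
        using AB(2,3) by (auto simp: open_contains_ball)
      obtain a where a: "snd p - e < a" "a < snd p" "(x, a) \<notin> X_infinity"
        using fibre_gaps[OF y, of "snd p - e" "snd p"] e(1) by auto
      obtain b where b: "snd p < b" "b < snd p + e" "(x, b) \<notin> X_infinity"
        using fibre_gaps[OF y, of "snd p" "snd p + e"] e(1) by auto
      define V where "V = ?G \<inter> ({x'. \<forall>k<n. x' k = x k} \<times> {a<..<b})"
      have "openin (top_of_set ?G) V"
        unfolding V_def by (intro openin_open_Int open_Times open_cylinder open_greaterThanLessThan)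
      moreover have "closedin (top_of_set ?G) V"
      proof -
        \<comment> \<open>Points of the set at the heights \<open>a\<close> and \<open>b\<close> lie
          off the fibre, hence are isolated; taking them away from the closed box leaves
          \<open>V\<close>, which is therefore closed.\<close>
        let ?D = "{r \<in> ?G. snd r = a \<or> snd r = b}"
        have "openin (top_of_set ?G) ?D"
        proof (subst openin_subopen, intro ballI)
          fix r assume r: "r \<in> ?D"
          then have "r \<in> X_infinity" "snd r = a \<or> snd r = b"
            using fibre_with_subset by blast+
          then have "fst r \<noteq> x"
            using a(3) b(3) by (metis prod.collapse)
          then obtain U where "open U" "r \<in> U" "U \<inter> ?G \<subseteq> {r}"
            by (rule fibre_with_isolated)
          then show "\<exists>T. openin (top_of_set ?G) T \<and> r \<in> T \<and> T \<subseteq> ?D"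
            using r by (intro exI[of _ "?G \<inter> U"]) auto
        qed
        moreover have "closedin (top_of_set ?G) (?G \<inter> ({x'. \<forall>k<n. x' k = x k} \<times> {a..b}))"
          by (intro closedin_closed_Int closed_Times closed_cylinder) auto
        moreover have "V = ?G \<inter> ({x'. \<forall>k<n. x' k = x k} \<times> {a..b}) - ?D"
          by (auto simp: V_def)
        ultimately show ?thesis by (simp add: closedin_diff)
      qed
      moreover have "p \<in> V"
        using p True a b by (cases p) (auto simp: V_def)
      moreover have "V \<subseteq> U'"
        using n e(2) a b AB(4) unfolding V_def W(2) by (fastforce simp: dist_real_def subset_iff)
      ultimately show ?thesis by blast
    qed
  qed
  then show ?thesis
    unfolding zero_dimensional_def
    by (intro exI[of _ "{V. openin (top_of_set ?G) V \<and> closedin (top_of_set ?G) V}"]) auto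
qed

text \<open>Otherwise no point is missing and the set contains a full interval. By connectedness a
  clopen neighbourhood of \<open>(x, 0)\<close> contains this interval and cannot stay below the
  height \<open>1/2\<close>.\<close>

lemma zero_dimensional_fibre_with_only_if:
  assumes "zero_dimensional (top_of_set (fibre_with x E))"
  shows "\<exists>y. \<forall>z. ((x, y), z) \<notin> universal_closed"
proof (rule ccontr)
  assume *: "\<not> ?thesis"
  let ?G = "fibre_with x E"
  have "(x, t) \<in> base_fibres" for t
    using * by (auto simp: base_fibres_def)
  then have line: "(x, t) \<in> ?G" if "0 \<le> t" "t \<le> 1" for t
    using that by (auto simp: fibre_with_def X_infinity_def)
  have "open (UNIV \<times> {..<1/2} :: ((nat \<Rightarrow> bool) \<times> real) set)"
    by (intro open_Times) auto
  then have "openin (top_of_set ?G) (?G \<inter> UNIV \<times> {..<1/2})"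
    by auto
  moreover have "(x, 0) \<in> ?G \<inter> UNIV \<times> {..<1/2}" using line by auto
  ultimately obtain V where V: "openin (top_of_set ?G) V" "closedin (top_of_set ?G) V"
    "(x, 0) \<in> V" "V \<subseteq> ?G \<inter> UNIV \<times> {..<1/2}"
    using assms unfolding zero_dimensional_def by meson
  obtain W where W: "open W" "V = ?G \<inter> W" using V(1) by (auto simp: openin_open)
  obtain C where C: "closed C" "V = ?G \<inter> C" using V(2) by (auto simp: closedin_closed)
  let ?S = "{t \<in> {0..1}. (x, t) \<in> V}"
  have cont: "continuous_on UNIV (\<lambda>t::real. (x, t))"
    by (intro continuous_intros)
  have "?S = {0..1} \<inter> (\<lambda>t. (x, t)) -` W"
    using line W(2) by auto
  moreover have "open ((\<lambda>t. (x, t)) -` W)"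
    using W(1) cont by (rule open_vimage)
  ultimately have "openin (top_of_set {0..1}) ?S" by (simp only: openin_open_Int)
  moreover have "?S = {0..1} \<inter> (\<lambda>t. (x, t)) -` C"
    using line C(2) by auto
  moreover have "closed ((\<lambda>t. (x, t)) -` C)"
    using C(1) cont by (rule closed_vimage)
  ultimately have "closedin (top_of_set {0..1}) ?S" by (simp only: closedin_closed_Int)
  with \<open>openin (top_of_set {0..1}) ?S\<close> have "?S = {} \<or> ?S = {0..1}"
    using connected_clopen[of "{0..1::real}"] connected_Icc by blast
  moreover have "0 \<in> ?S" using V(3) by simp
  moreover have "1 \<notin> ?S" using V(4) by auto
  moreover have "(1::real) \<in> {0..1}" by simp
  ultimately show False by blast
qed

end

section \<open>Hardness\<close>

definition interleave :: "(nat \<Rightarrow> bool) \<Rightarrow> (nat \<Rightarrow> bool) \<Rightarrow> nat \<Rightarrow> bool" where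
  "interleave u a k = (if k mod 3 = 0 then u (k div 3) else k mod 3 = 1 \<and> a (k div 3))"

lemma interleave_simps:
  "interleave u a (3 * n) = u n"
  "interleave u a (3 * n + 1) = a n"
  "interleave u a \<in> sparse_seqs"
proof -
  have "(3 * n + 1) mod 3 = (1::nat)" "(3 * n + 2) mod 3 = (2::nat)"
    "(3 * n + 1) div 3 = n" for n :: nat
    by presburger+
  then show "interleave u a (3 * n) = u n" "interleave u a (3 * n + 1) = a n"
    "interleave u a \<in> sparse_seqs"
    by (simp_all add: interleave_def sparse_seqs_def)
qed

text \<open>As \<open>k div 3 \<le> k\<close>, the interleaved sequence is determined up to
  \<open>n\<close> by \<open>a\<close> up to \<open>n\<close>.\<close>

lemma interleave_cong: "(\<And>k. k < n \<Longrightarrow> a k = a' k) \<Longrightarrow> k < n \<Longrightarrow> interleave u a k = interleave u a' k"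
  by (auto simp: interleave_def)

context Metric_space
begin

text \<open>The choice depends on \<open>n\<close> and \<open>S\<close> only, so that equal sets get
  equal nets.\<close>

definition net :: "nat \<Rightarrow> 'a set \<Rightarrow> 'a set" where
  "net n S = (SOME E. finite E \<and> E \<subseteq> S \<and> (\<forall>p\<in>S. \<exists>e\<in>E. d e p < (1/2)^n))"

lemma net:
  assumes "compact_space mtopology" "S \<subseteq> M"
  shows "finite (net n S)" "net n S \<subseteq> S" "\<And>p. p \<in> S \<Longrightarrow> \<exists>e\<in>net n S. d e p < (1/2)^n"
proof -
  have "mtotally_bounded S"
    using assms compact_space_eq_mcomplete_mtotally_bounded mtotally_bounded_subset by blast
  then obtain E where "finite E" "E \<subseteq> S" "S \<subseteq> (\<Union>x\<in>E. mball x ((1/2)^n))"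
    unfolding mtotally_bounded_def by (metis zero_less_power half_gt_zero zero_less_one)
  then have "\<exists>E. finite E \<and> E \<subseteq> S \<and> (\<forall>p\<in>S. \<exists>e\<in>E. d e p < (1/2)^n)"
    by (intro exI[of _ E]) (auto simp: subset_iff)
  then have "finite (net n S) \<and> net n S \<subseteq> S \<and> (\<forall>p\<in>S. \<exists>e\<in>net n S. d e p < (1/2)^n)"
    unfolding net_def by (rule someI_ex)
  then show "finite (net n S)" "net n S \<subseteq> S" "\<And>p. p \<in> S \<Longrightarrow> \<exists>e\<in>net n S. d e p < (1/2)^n"
    by auto
qed

end

text \<open>Changing one far coordinate moves \<open>x\<close> out of \<open>sparse_seqs\<close> by
  an arbitrarily small amount, and there \<open>X_infinity\<close> contains the whole
  interval.\<close>

lemma fibre_near_outer_points: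
  assumes p: "p \<in> X_infinity" "fst p = x" and x: "x \<in> sparse_seqs"
    and U: "openin (top_of_set X_infinity) U" "p \<in> U"
  obtains r where "r \<in> outer_points n x" "r \<in> U"
proof -
  obtain W where W: "open W" "U = X_infinity \<inter> W"
    using U(1) by (auto simp: openin_open)
  have "p \<in> W" using U(2) W(2) by auto
  then obtain A B where AB: "open A" "open B" "p \<in> A \<times> B" "A \<times> B \<subseteq> W"
    using open_prod_elim[OF W(1)] by metis
  have "x \<in> A" using AB(3) p(2) by auto
  then obtain m where m: "{x'. \<forall>k<m. x' k = x k} \<subseteq> A"
    by (rule cylinder_subset_open[OF AB(1)])
  \<comment> \<open>This index lies beyond \<open>m\<close> and \<open>n\<close>, in the residue
    class where members of \<open>sparse_seqs\<close> vanish.\<close>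
  define x' where "x' = x(3 * (m + n) + 2 := True)"
  have "x' (3 * (m + n) + 2)" by (simp add: x'_def)
  then have "x' \<notin> sparse_seqs" unfolding sparse_seqs_def by blast
  moreover have x'x: "x' k = x k" if "k < m \<or> k < n" for k
    using that by (auto simp: x'_def)
  moreover have "0 \<le> snd p" "snd p \<le> 1"
    using p(1) by (auto simp: X_infinity_def)
  ultimately have "(x', snd p) \<in> outer_points n x"
    by (auto simp: outer_points_def)
  moreover have "(x', snd p) \<in> U"
  proof -
    have "x' \<in> A" using m x'x by blast
    then show ?thesis
      using AB(3,4) outer_points_subset[of n x] \<open>(x', snd p) \<in> outer_points n x\<close> unfolding W(2) by auto
  qed
  ultimately show thesis using that by blast
qed

lemma Sigma12_hard_zero_dim_closed_subsets:
  assumes "admissible_topology (top_of_set X_infinity) H"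
  shows "Sigma12_hard H (zero_dim_closed_subsets (top_of_set X_infinity))"
proof -
  obtain T where T: "compact_space T" "metrizable_space T" "X_infinity \<subseteq> topspace T"
    "subtopology T X_infinity = top_of_set X_infinity"
    and H: "H = pullback_topology (closed_subsets (top_of_set X_infinity)) (\<lambda>F. T closure_of F) (Vietoris T)"
    using assms unfolding admissible_topology_def by auto
  obtain M d where "Metric_space M d" and Td: "T = Metric_space.mtopology M d"
    using T(2) unfolding metrizable_space_def by blast
  then interpret Metric_space M d by simp
  have comp: "compact_space mtopology" and XM: "X_infinity \<subseteq> M"
    and sub: "subtopology mtopology X_infinity = top_of_set X_infinity"
    using T Td by auto
  define E where "E x n = net n (outer_points n x)" for x n
  have outM: "outer_points n x \<subseteq> M" for n x
    using outer_points_subset XM by blast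
  have E: "finite (E x n)" "E x n \<subseteq> outer_points n x"
    "\<And>p. p \<in> outer_points n x \<Longrightarrow> \<exists>e\<in>E x n. d e p < (1/2)^n" for x n
    unfolding E_def using net[OF comp outM] by auto
  define G where "G x = fibre_with x (E x)" for x
  have GX: "G x \<subseteq> X_infinity" if "x \<in> sparse_seqs" for x
    unfolding G_def using that E(1,2) by (rule fibre_with_subset)
  \<comment> \<open>One half of the Hausdorff continuity; the other half follows by exchanging
    \<open>x\<close> and \<open>x'\<close>.\<close>
  have near: "\<exists>p'\<in>G x'. d p p' < \<epsilon>"
    if x: "x \<in> sparse_seqs" and agree: "\<And>k. k < n \<Longrightarrow> x k = x' k" and \<epsilon>: "\<epsilon> > 0" "(1/2)^n < \<epsilon> / 2"
      and p: "p \<in> G x" for x x' n \<epsilon> p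
  proof -
    have from_outer: "\<exists>p'\<in>G x'. d r p' < \<epsilon> / 2" if r: "r \<in> outer_points n x" for r
    proof -
      have "r \<in> outer_points n x'"
        using r outer_points_cong[of n x x'] agree by simp
      then obtain e where "e \<in> E x' n" "d e r < (1/2)^n" using E(3) by blast
      moreover have "e \<in> G x'" using \<open>e \<in> E x' n\<close> by (auto simp: G_def fibre_with_def)
      ultimately show ?thesis
        using \<epsilon>(2) by (intro bexI[of _ e]) (auto simp: commute)
    qed
    have pM: "p \<in> M" using GX[OF x] p XM by blast
    \<comment> \<open>Nets of index below \<open>n\<close> are the same for \<open>x\<close> and
      \<open>x'\<close>. Points of later nets are outer points of level \<open>n\<close>, and points
      of the fibre are close to such; the \<open>n\<close>-th net of \<open>x'\<close> approximates
      all of these.\<close>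
    consider (old) j where "j < n" "p \<in> E x j" | (new) j where "n \<le> j" "p \<in> E x j"
      | (fibre) "p \<in> X_infinity" "fst p = x"
      using p unfolding G_def fibre_with_def by (metis (no_types, lifting) Int_iff UN_E Un_iff
          fst_conv mem_Sigma_iff not_less prod.collapse singletonD)
    then show ?thesis
    proof cases
      case old
      then have "E x j = E x' j"
        using outer_points_cong[of j x x'] agree by (simp add: E_def)
      then have "p \<in> G x'" using old(2) by (auto simp: G_def fibre_with_def)
      then show ?thesis using pM \<epsilon>(1) by (intro bexI[of _ p]) auto
    next
      case new
      then have "p \<in> outer_points n x"
        using E(2)[of x j] outer_points_mono[of n j x] by blast
      from from_outer[OF this] show ?thesis using \<epsilon>(1) by force
    next
      case fibre
      \<comment> \<open>On \<open>X_infinity\<close> the balls of the given compactification are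
        open in the usual topology, so outer points can be found in them.\<close>
      have "openin (top_of_set X_infinity) (X_infinity \<inter> mball p (\<epsilon> / 2))"
        unfolding sub[symmetric] by (intro openin_subtopology_Int2 openin_mball)
      moreover have "p \<in> X_infinity \<inter> mball p (\<epsilon> / 2)"
        using fibre(1) pM \<epsilon>(1) by simp
      ultimately obtain r where r: "r \<in> outer_points n x" "r \<in> X_infinity \<inter> mball p (\<epsilon> / 2)"
        by (rule fibre_near_outer_points[OF fibre x])
      obtain p' where p': "p' \<in> G x'" "d r p' < \<epsilon> / 2"
        using from_outer[OF r(1)] by blast
      have "d p p' \<le> d p r + d r p'"
      proof (rule triangle)
        show "p' \<in> M"
          using p'(1) E(2) outM XM unfolding G_def fibre_with_def by blast
      qed (use pM r(2) in auto)
      then show ?thesis using r(2) p' by (intro bexI[of _ p']) auto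
    qed
  qed
  show ?thesis
    unfolding Sigma12_hard_def
  proof (intro allI impI)
    fix A assume "Sigma12_in Cantor_space A"
    then obtain u where u: "\<And>x. (\<And>n. x (3 * n) = u n) \<Longrightarrow>
        (\<lambda>n. x (3 * n + 1)) \<in> A \<longleftrightarrow> (\<exists>y. \<forall>z. ((x, y), z) \<notin> universal_closed)"
      using Sigma12_universal by blast
    let ?x = "interleave u"
    define \<phi> where "\<phi> a = G (?x a)" for a
    have sparse: "?x a \<in> sparse_seqs" for a by (rule interleave_simps)
    have "continuous_map Cantor_space (Vietoris mtopology) (\<lambda>a. mtopology closure_of \<phi> a)"
    proof (rule continuous_map_Vietoris_closure[OF comp])
      show "\<phi> a \<subseteq> M" for a
        using GX[OF sparse] XM by (auto simp: \<phi>_def)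
      fix a :: "nat \<Rightarrow> bool" and \<epsilon> :: real assume \<epsilon>: "\<epsilon> > 0"
      obtain n where n: "(1/2::real)^n < \<epsilon> / 2"
        using real_arch_pow_inv[of "\<epsilon> / 2" "1/2"] \<epsilon> by auto
      let ?W = "{a'. \<forall>k<n. a' k = a k}"
      have "(\<forall>p\<in>\<phi> a. \<exists>p'\<in>\<phi> a'. d p p' < \<epsilon>) \<and> (\<forall>p'\<in>\<phi> a'. \<exists>p\<in>\<phi> a. d p p' < \<epsilon>)"
        if "a' \<in> ?W" for a'
      proof -
        have agree: "?x a k = ?x a' k" if "k < n" for k
          using \<open>a' \<in> ?W\<close> that by (intro interleave_cong[of n]) auto
        show ?thesis
          using near[OF sparse, of n a "?x a'" \<epsilon>] near[OF sparse, of n a' "?x a" \<epsilon>] agree \<epsilon> n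
          unfolding \<phi>_def by (metis commute)
      qed
      then show "\<exists>W. openin Cantor_space W \<and> a \<in> W \<and> (\<forall>a'\<in>W. (\<forall>p\<in>\<phi> a. \<exists>p'\<in>\<phi> a'. d p p' < \<epsilon>) \<and>
          (\<forall>p'\<in>\<phi> a'. \<exists>p\<in>\<phi> a. d p p' < \<epsilon>))"
        by (intro exI[of _ ?W]) (auto simp: open_cylinder)
    qed
    moreover have closed: "closedin (top_of_set X_infinity) (\<phi> a)" for a
      unfolding \<phi>_def G_def using sparse E(1,2) by (rule closedin_fibre_with)
    ultimately have "continuous_map Cantor_space H \<phi>"
      unfolding H Td by (intro continuous_map_pullback') (auto simp: o_def closed_subsets_def)
    moreover have "a \<in> A \<longleftrightarrow> \<phi> a \<in> zero_dim_closed_subsets (top_of_set X_infinity)" for a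
    proof -
      have "a \<in> A \<longleftrightarrow> (\<exists>y. \<forall>z. ((?x a, y), z) \<notin> universal_closed)"
        using u[of "?x a"] interleave_simps by simp
      also have "\<dots> \<longleftrightarrow> zero_dimensional (top_of_set (\<phi> a))"
        unfolding \<phi>_def G_def
        using zero_dimensional_fibre_with_if[of "?x a" "E (?x a)"]
          zero_dimensional_fibre_with_only_if[of "?x a" "E (?x a)"] sparse E(1,2) by blast
      also have "top_of_set (\<phi> a) = subtopology (top_of_set X_infinity) (\<phi> a)"
        using closedin_subset[OF closed[of a]] by (simp add: subtopology_subtopology Int_absorb1)
      finally show ?thesis
        using closed[of a] by (simp add: zero_dim_closed_subsets_def closed_subsets_def)
    qed
    ultimately show "\<exists>\<phi>. continuous_map Cantor_space H \<phi> \<and>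
        A = \<phi> -` zero_dim_closed_subsets (top_of_set X_infinity)"
      by (intro exI[of _ \<phi>]) auto
  qed
qed

section \<open>Membership\<close>

text \<open>The sequence \<open>g\<close> describes two open sets for each pair \<open>i\<close>,
  \<open>k\<close>: its entry for \<open>l\<close> puts \<open>b l\<close> into the first set (value
  \<open>1\<close>), into the second (value \<open>2\<close>) or into neither.\<close>

definition in_code :: "(nat \<Rightarrow> 'a set) \<Rightarrow> (nat \<Rightarrow> nat) \<Rightarrow> nat \<Rightarrow> nat \<Rightarrow> 'a \<Rightarrow> bool" where
  "in_code b g i k x \<longleftrightarrow> (\<exists>l. x \<in> b l \<and> g (prod_encode (i, prod_encode (k, l))) = 1)"

definition out_code :: "(nat \<Rightarrow> 'a set) \<Rightarrow> (nat \<Rightarrow> nat) \<Rightarrow> nat \<Rightarrow> nat \<Rightarrow> 'a \<Rightarrow> bool" where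
  "out_code b g i k x \<longleftrightarrow> (\<exists>l. x \<in> b l \<and> g (prod_encode (i, prod_encode (k, l))) = 2)"

text \<open>For every \<open>i\<close>, the \<open>i\<close>-th basic open set is, on the set of the points satisfying this condition,
  the union over \<open>k\<close> of relatively clopen sets.\<close>

definition codes_clopen_base :: "(nat \<Rightarrow> 'a set) \<Rightarrow> (nat \<Rightarrow> nat) \<Rightarrow> 'a \<Rightarrow> bool" where
  "codes_clopen_base b g x \<longleftrightarrow>
     (\<forall>i k. (in_code b g i k x \<longleftrightarrow> \<not> out_code b g i k x) \<and> (in_code b g i k x \<longrightarrow> x \<in> b i)) \<and>
     (\<forall>i. x \<in> b i \<longrightarrow> (\<exists>k. in_code b g i k x))"

text \<open>Zero-dimensionality is turned into one existential quantifier over the Baire space,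
  followed by a condition on single points of \<open>F\<close>. To find \<open>g\<close>, the
  Lindelof property is used to write each \<open>F \<inter> b i\<close> as a countable union of
  clopen sets.\<close>

lemma zero_dimensional_iff_code:
  fixes F :: "'a::second_countable_topology set"
  assumes b: "\<And>n. open (b n)" "\<And>U. open U \<Longrightarrow> \<exists>u. U = (\<Union>n\<in>Collect u. b n)"
  shows "zero_dimensional (top_of_set F) \<longleftrightarrow> (\<exists>g. \<forall>x\<in>F. codes_clopen_base b g x)"
proof
  assume "\<exists>g. \<forall>x\<in>F. codes_clopen_base b g x"
  then obtain g where g: "\<And>x. x \<in> F \<Longrightarrow> codes_clopen_base b g x" by blast
  have op: "openin (top_of_set F) {x \<in> F. in_code b g i k x}" "openin (top_of_set F) {x \<in> F. out_code b g i k x}"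
    for i k
  proof -
    have "{x \<in> F. in_code b g i k x} =
        F \<inter> (\<Union>l\<in>{l. g (prod_encode (i, prod_encode (k, l))) = 1}. b l)"
      "{x \<in> F. out_code b g i k x} =
        F \<inter> (\<Union>l\<in>{l. g (prod_encode (i, prod_encode (k, l))) = 2}. b l)"
      by (auto simp: in_code_def out_code_def)
    then show "openin (top_of_set F) {x \<in> F. in_code b g i k x}" "openin (top_of_set F) {x \<in> F. out_code b g i k x}"
      using b(1) by (auto intro!: openin_open_Int open_UN)
  qed
  have "\<exists>V. openin (top_of_set F) V \<and> closedin (top_of_set F) V \<and> x \<in> V \<and> V \<subseteq> U"
    if U: "openin (top_of_set F) U" "x \<in> U" for U x
  proof -
    obtain W where W: "open W" "U = F \<inter> W" using U(1) by (auto simp: openin_open)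
    obtain i where i: "x \<in> b i" "b i \<subseteq> W"
      using b(2)[OF W(1)] U(2) W(2) by auto
    have xF: "x \<in> F" using U(2) W(2) by auto
    obtain k where k: "in_code b g i k x"
      using g[OF xF] i(1) unfolding codes_clopen_base_def by blast
    let ?V = "{x \<in> F. in_code b g i k x}"
    have "F - ?V = {x \<in> F. out_code b g i k x}"
      using g unfolding codes_clopen_base_def by blast
    then have "closedin (top_of_set F) ?V"
      using op(2)[of i k] by (simp add: closedin_def)
    moreover have "?V \<subseteq> U"
      using g i(2) unfolding W(2) codes_clopen_base_def by blast
    ultimately show ?thesis
      using op(1)[of i k] xF k by (intro exI[of _ ?V]) auto
  qed
  then show "zero_dimensional (top_of_set F)"
    unfolding zero_dimensional_def
    by (intro exI[of _ "{V. openin (top_of_set F) V \<and> closedin (top_of_set F) V}"]) auto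
next
  assume zd: "zero_dimensional (top_of_set F)"
  define clopen where "clopen V \<longleftrightarrow> openin (top_of_set F) V \<and> closedin (top_of_set F) V" for V
  have "\<exists>V. (\<forall>k::nat. clopen (V k)) \<and> (\<Union>k. V k) = F \<inter> b i" for i
  proof -
    let ?\<V> = "{V. clopen V \<and> V \<subseteq> F \<inter> b i}"
    have "\<Union>?\<V> = F \<inter> b i"
    proof (intro subset_antisym subsetI)
      fix x assume x: "x \<in> F \<inter> b i"
      have "openin (top_of_set F) (F \<inter> b i)" using b(1) by auto
      then obtain V where "clopen V" "x \<in> V" "V \<subseteq> F \<inter> b i"
        using zd x unfolding zero_dimensional_def clopen_def by meson
      then show "x \<in> \<Union>?\<V>" by blast
    qed auto
    moreover obtain \<V>' where \<V>': "\<V>' \<subseteq> ?\<V>" "countable \<V>'" "\<Union>\<V>' = \<Union>?\<V>"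
      by (rule Lindelof_openin[of ?\<V> F]) (auto simp: clopen_def)
    \<comment> \<open>The empty set is added so that the family is nonempty and can be
      enumerated.\<close>
    ultimately have un: "\<Union>(insert {} \<V>') = F \<inter> b i" by simp
    have r: "range (from_nat_into (insert {} \<V>')) = insert {} \<V>'"
      using \<V>'(2) by (intro range_from_nat_into) auto
    have "clopen V" if "V \<in> insert {} \<V>'" for V
      using that \<V>'(1) by (auto simp: clopen_def)
    then have "\<forall>k. clopen (from_nat_into (insert {} \<V>') k)"
      using r by blast
    then show ?thesis
      using un r by (intro exI[of _ "from_nat_into (insert {} \<V>')"]) simp
  qed
  then obtain V where V: "\<And>i k::nat. clopen (V i k)" "\<And>i. (\<Union>k. V i k) = F \<inter> b i"
    by metis
  have "\<exists>u. V i k = F \<inter> (\<Union>l\<in>Collect u. b l)" for i k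
    using V(1)[of i k] b(2) unfolding clopen_def openin_open by metis
  then obtain u where u: "\<And>i k. V i k = F \<inter> (\<Union>l\<in>Collect (u i k). b l)"
    by metis
  have "\<exists>v. F - V i k = F \<inter> (\<Union>l\<in>Collect v. b l)" for i k
  proof -
    have "openin (top_of_set F) (F - V i k)"
      using V(1)[of i k] by (simp add: clopen_def openin_diff)
    then show ?thesis using b(2) unfolding openin_open by metis
  qed
  then obtain v where v: "\<And>i k. F - V i k = F \<inter> (\<Union>l\<in>Collect (v i k). b l)"
    by metis
  \<comment> \<open>Giving \<open>u\<close> precedence over \<open>v\<close> loses nothing: a set
    \<open>b l\<close> listed in both does not meet \<open>F\<close>.\<close>
  define g where "g m = (case prod_decode m of (i, m') \<Rightarrow> (case prod_decode m' of (k, l) \<Rightarrow>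
    (if u i k l then 1 else if v i k l then 2 else 0 :: nat)))" for m
  have g: "g (prod_encode (i, prod_encode (k, l))) = (if u i k l then 1 else if v i k l then 2 else 0)" for i k l
    by (simp add: g_def)
  have "codes_clopen_base b g x" if x: "x \<in> F" for x
  proof -
    have ins: "in_code b g i k x \<longleftrightarrow> x \<in> V i k" for i k
      using x u[of i k] by (auto simp: in_code_def g)
    have outs: "out_code b g i k x \<longleftrightarrow> x \<notin> V i k" for i k
    proof
      assume "out_code b g i k x"
      then show "x \<notin> V i k"
        using x v[of i k] by (auto simp: out_code_def g split: if_splits)
    next
      assume "x \<notin> V i k"
      then obtain l where l: "x \<in> b l" "v i k l" using x v[of i k] by blast
      moreover have "\<not> u i k l" using \<open>x \<notin> V i k\<close> l(1) x u[of i k] by blast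
      ultimately show "out_code b g i k x" by (auto simp: out_code_def g)
    qed
    show ?thesis
      unfolding codes_clopen_base_def ins outs using V(2) x by blast
  qed
  then show "\<exists>g. \<forall>x\<in>F. codes_clopen_base b g x" by blast
qed

section \<open>Codes for nonempty closed subsets of an analytic set\<close>

lemma continuous_on_slice:
  "continuous_on UNIV (\<lambda>w::nat \<Rightarrow> nat. \<lambda>k. w (prod_encode (i, k)))"
  by (intro continuous_on_coordinatewise_then_product continuous_on_product_coordinates)

lemma metrizable_Baire_space: "metrizable_space Baire_space"
  by (rule completely_metrizable_imp_metrizable_space[OF completely_metrizable_discrete_sequences])

text \<open>Rows \<open>0\<close> and \<open>1\<close> of a code are reserved for the modulus and
  for a description of clopen sets, hence the shift by \<open>2\<close>.\<close>

definition point :: "((nat \<Rightarrow> nat) \<Rightarrow> 'a) \<Rightarrow> (nat \<Rightarrow> nat) \<Rightarrow> nat \<Rightarrow> 'a" where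
  "point \<rho> w m = \<rho> (\<lambda>k. w (prod_encode (m + 2, k)))"

definition modulus :: "(nat \<Rightarrow> nat) \<Rightarrow> nat \<Rightarrow> nat" where
  "modulus w n = w (prod_encode (0, n))"

definition base_code :: "(nat \<Rightarrow> nat) \<Rightarrow> nat \<Rightarrow> nat" where
  "base_code w n = w (prod_encode (1, n))"

lemma code_exists:
  obtains w where "\<And>m. point \<rho> w m = \<rho> (p m)" "modulus w = h" "base_code w = g"
proof
  let ?w = "\<lambda>m. case prod_decode m of (i, k) \<Rightarrow> if i = 0 then h k else if i = 1 then g k else p (i - 2) k"
  show "point \<rho> ?w m = \<rho> (p m)" for m by (simp add: point_def)
  show "modulus ?w = h" "base_code ?w = g" by (auto simp: modulus_def base_code_def)
qed

text \<open>Here \<open>d\<close> is a metric of the compactification and \<open>\<rho>\<close> a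
  parametrization of the analytic set \<open>X\<close>. The base \<open>b\<close> belongs to the
  topology of the type, which is tied to that of \<open>d\<close> on \<open>X\<close>.\<close>

locale coded_hyperspace = Metric_space M d for M :: "'a::second_countable_topology set" and d +
  fixes X :: "'a set" and \<rho> :: "(nat \<Rightarrow> nat) \<Rightarrow> 'a" and b :: "nat \<Rightarrow> 'a set"
  assumes comp: "compact_space mtopology" and XM: "X \<subseteq> M"
    and sub: "subtopology mtopology X = top_of_set X"
    and cont_\<rho>: "continuous_on UNIV \<rho>" and range_\<rho>: "range \<rho> = X"
    and open_b: "\<And>n. open (b n)" and base_b: "\<And>U. open U \<Longrightarrow> \<exists>u. U = (\<Union>n\<in>Collect u. b n)"
begin

text \<open>A code is a dense sequence in a closed set together with a modulus of total boundedness. The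
  modulus is what makes decoding continuous, and not only lower semicontinuous.\<close>

definition codes :: "(nat \<Rightarrow> nat) set" where
  "codes = {w. \<forall>n m. \<exists>j\<le>modulus w n. d (point \<rho> w m) (point \<rho> w j) \<le> (1/2)^n}"

definition decode :: "(nat \<Rightarrow> nat) \<Rightarrow> 'a set" where
  "decode w = X \<inter> mtopology closure_of range (point \<rho> w)"

lemma point_X: "point \<rho> w m \<in> X"
  using range_\<rho> by (auto simp: point_def)

lemma point_M: "point \<rho> w m \<in> M"
  using point_X XM by blast

lemma continuous_map_\<rho>: "continuous_map Baire_space mtopology \<rho>"
proof -
  have "continuous_map Baire_space (top_of_set X) \<rho>"
    using cont_\<rho> range_\<rho> by (auto simp: continuous_map_in_subtopology)
  then show ?thesis
    unfolding sub[symmetric] by (simp add: continuous_map_in_subtopology)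
qed

text \<open>Distances are taken between values of \<open>\<rho>\<close> because the two topologies
  are known to agree on \<open>X\<close> only.\<close>

lemma continuous_on_d:
  fixes f g :: "'c::topological_space \<Rightarrow> nat \<Rightarrow> nat"
  assumes "continuous_on UNIV f" "continuous_on UNIV g"
  shows "continuous_on UNIV (\<lambda>u. d (\<rho> (f u)) (\<rho> (g u)))"
proof -
  have "continuous_map euclidean mtopology (\<lambda>u. \<rho> (f u))" "continuous_map euclidean mtopology (\<lambda>u. \<rho> (g u))"
    using continuous_map_compose[OF _ continuous_map_\<rho>, of euclidean f]
      continuous_map_compose[OF _ continuous_map_\<rho>, of euclidean g] assms by (simp_all add: o_def)
  then have "continuous_map euclidean euclideanreal (\<lambda>u. d (\<rho> (f u)) (\<rho> (g u)))"
    using continuous_map_mdist[of euclidean "metric (M, d)" "\<lambda>u. \<rho> (f u)" "\<lambda>u. \<rho> (g u)"]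
    by (simp add: mtopology_of_def)
  then show ?thesis by simp
qed

lemma open_modulus: "open {w. modulus w n = N}"
proof -
  have "{w. modulus w n = N} = (\<lambda>w. w (prod_encode (0, n))) -` {N}"
    by (auto simp: modulus_def)
  then show ?thesis by (simp add: open_vimage open_discrete)
qed

text \<open>The modulus at \<open>n\<close> is locally constant, so violating the condition for
  given \<open>n\<close> and \<open>m\<close> amounts locally to finitely many strict
  inequalities.\<close>

lemma closed_codes: "closed codes"
proof -
  have "open {w. \<forall>j\<le>modulus w n. d (point \<rho> w m) (point \<rho> w j) > (1/2)^n}" for n m
  proof -
    have "{w. \<forall>j\<le>modulus w n. d (point \<rho> w m) (point \<rho> w j) > (1/2)^n} =
        (\<Union>N. {w. modulus w n = N} \<inter> (\<Inter>j\<in>{..N}. {w. (1/2)^n < d (point \<rho> w m) (point \<rho> w j)}))"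
      by auto
    moreover have "open \<dots>"
      unfolding point_def
      by (intro open_UN ballI open_Int open_modulus open_INT finite_atMost open_Collect_less
          continuous_on_const continuous_on_d continuous_on_slice)
    ultimately show ?thesis by simp
  qed
  then have "open (\<Union>n. \<Union>m. {w. \<forall>j\<le>modulus w n. d (point \<rho> w m) (point \<rho> w j) > (1/2)^n})"
    by blast
  moreover have "- codes = (\<Union>n. \<Union>m. {w. \<forall>j\<le>modulus w n. d (point \<rho> w m) (point \<rho> w j) > (1/2)^n})"
    unfolding codes_def not_le[symmetric] by blast
  ultimately show ?thesis by (simp add: closed_def)
qed

lemma closure_decode: "mtopology closure_of decode w = mtopology closure_of range (point \<rho> w)"
proof (rule subset_antisym)
  show "mtopology closure_of decode w \<subseteq> mtopology closure_of range (point \<rho> w)"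
    unfolding decode_def by (rule closure_of_minimal) auto
  have "range (point \<rho> w) \<subseteq> decode w"
    using closure_of_subset[of "range (point \<rho> w)" mtopology] point_X point_M
    unfolding decode_def by auto
  then show "mtopology closure_of range (point \<rho> w) \<subseteq> mtopology closure_of decode w"
    by (rule closure_of_mono)
qed

lemma closedin_decode: "closedin (top_of_set X) (decode w)"
  unfolding decode_def sub[symmetric] by (simp add: closedin_subtopology_Int_closed)

text \<open>For codes \<open>v\<close> near \<open>w\<close>, the modulus at \<open>n\<close> is
  unchanged and the points with index up to it have moved by less than
  \<open>\<epsilon> / 2\<close>. Each of the two sequences stays within \<open>(1/2)^n\<close> of
  its own initial points.\<close>

lemma continuous_map_decode:
  "continuous_map (top_of_set codes)
     (pullback_topology (closed_subsets (top_of_set X)) (\<lambda>F. mtopology closure_of F) (Vietoris mtopology)) decode"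
proof (rule continuous_map_pullback')
  have "continuous_map (top_of_set codes) (Vietoris mtopology)
      (\<lambda>w. mtopology closure_of range (point \<rho> w))"
  proof (rule continuous_map_Vietoris_closure[OF comp])
    show "range (point \<rho> w) \<subseteq> M" for w using point_M by auto
    fix w and \<epsilon> :: real assume w: "w \<in> topspace (top_of_set codes)" and \<epsilon>: "\<epsilon> > 0"
    then have wc: "w \<in> codes" by simp
    obtain n where n: "(1/2::real)^n < \<epsilon> / 2"
      using real_arch_pow_inv[of "\<epsilon> / 2" "1/2"] \<epsilon> by auto
    let ?W = "{v. modulus v n = modulus w n} \<inter>
      (\<Inter>j\<in>{..modulus w n}. {v. d (point \<rho> w j) (point \<rho> v j) < \<epsilon> / 2})"
    have "open ?W"
      unfolding point_def
      by (intro open_Int open_modulus open_INT finite_atMost ballI open_Collect_less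
          continuous_on_const continuous_on_d continuous_on_slice)
    moreover have "w \<in> ?W"
      using \<epsilon> point_M by auto
    moreover have "(\<forall>p\<in>range (point \<rho> w). \<exists>p'\<in>range (point \<rho> v). d p p' < \<epsilon>) \<and>
        (\<forall>p'\<in>range (point \<rho> v). \<exists>p\<in>range (point \<rho> w). d p p' < \<epsilon>)"
      if v: "v \<in> codes \<inter> ?W" for v
    proof (intro conjI ballI)
      fix p assume "p \<in> range (point \<rho> w)"
      then obtain m where m: "p = point \<rho> w m" by blast
      obtain j where j: "j \<le> modulus w n" "d (point \<rho> w m) (point \<rho> w j) \<le> (1/2)^n"
        using wc unfolding codes_def by blast
      have "d (point \<rho> w j) (point \<rho> v j) < \<epsilon> / 2" using v j(1) by auto
      then have "d p (point \<rho> v j) < \<epsilon>"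
        using triangle[of p "point \<rho> w j" "point \<rho> v j"] point_M j(2) n unfolding m by auto
      then show "\<exists>p'\<in>range (point \<rho> v). d p p' < \<epsilon>" by blast
    next
      fix p' assume "p' \<in> range (point \<rho> v)"
      then obtain m where m: "p' = point \<rho> v m" by blast
      obtain j where j: "j \<le> modulus v n" "d (point \<rho> v m) (point \<rho> v j) \<le> (1/2)^n"
        using v unfolding codes_def by blast
      have "d (point \<rho> w j) (point \<rho> v j) < \<epsilon> / 2" using v j(1) by auto
      then have "d (point \<rho> w j) p' < \<epsilon>"
        using triangle[of "point \<rho> w j" "point \<rho> v j" p'] point_M j(2) n unfolding m
        by (auto simp: commute)
      then show "\<exists>p\<in>range (point \<rho> w). d p p' < \<epsilon>" by blast
    qed
    ultimately show "\<exists>W. openin (top_of_set codes) W \<and> w \<in> W \<and>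
      (\<forall>v\<in>W. (\<forall>p\<in>range (point \<rho> w). \<exists>p'\<in>range (point \<rho> v). d p p' < \<epsilon>) \<and>
        (\<forall>p'\<in>range (point \<rho> v). \<exists>p\<in>range (point \<rho> w). d p p' < \<epsilon>))"
      using wc by (intro exI[of _ "codes \<inter> ?W"] conjI openin_open_Int IntI ballI) blast+
  qed
  then show "continuous_map (top_of_set codes) (Vietoris mtopology) ((\<lambda>F. mtopology closure_of F) \<circ> decode)"
    by (simp add: o_def closure_decode)
  show "topspace (top_of_set codes) \<subseteq> decode -` closed_subsets (top_of_set X)"
    using closedin_decode by (auto simp: closed_subsets_def)
qed

text \<open>The sequence enumerates the union of the finite nets of \<open>F\<close>; the modulus at
  \<open>n\<close> is an index by which the \<open>n\<close>-th net has been listed. The row for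
  \<open>g\<close> can be filled at will.\<close>

lemma decode_surj:
  assumes F: "closedin (top_of_set X) F" "F \<noteq> {}"
  obtains w where "w \<in> codes" "decode w = F" "base_code w = g"
proof -
  have FX: "F \<subseteq> X" using closedin_subset[OF F(1)] by simp
  then have FM: "F \<subseteq> M" using XM by blast
  note net = net[OF comp FM]
  define C where "C = (\<Union>n. net n F)"
  have CF: "C \<subseteq> F" using net(2) by (auto simp: C_def)
  have "countable C" using net(1) by (simp add: C_def countable_finite)
  moreover have "C \<noteq> {}" using net(3) F(2) unfolding C_def by blast
  ultimately have r: "range (from_nat_into C) = C" by (intro range_from_nat_into)
  have "\<exists>N. \<forall>m. \<exists>j\<le>N. d (from_nat_into C m) (from_nat_into C j) \<le> (1/2)^n" for n
  proof -
    have "net n F \<subseteq> from_nat_into C ` UNIV" using r by (auto simp: C_def)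
    then obtain J where J: "finite J" "net n F = from_nat_into C ` J"
      using finite_subset_image[OF net(1)] by metis
    obtain N where N: "\<forall>j\<in>J. j \<le> N"
      using J(1) by (auto simp: finite_nat_set_iff_bounded_le)
    have "\<exists>j\<le>N. d (from_nat_into C m) (from_nat_into C j) \<le> (1/2)^n" for m
    proof -
      have "from_nat_into C m \<in> F" using r CF by blast
      then obtain e where "e \<in> net n F" "d e (from_nat_into C m) < (1/2)^n"
        using net(3) by blast
      then show ?thesis
        unfolding J(2) using N by (force simp: commute)
    qed
    then show ?thesis by blast
  qed
  then obtain h where h: "\<And>n m. \<exists>j\<le>h n. d (from_nat_into C m) (from_nat_into C j) \<le> (1/2)^n"
    by metis
  have "\<forall>m. \<exists>y. from_nat_into C m = \<rho> y"
    using r CF FX range_\<rho> by blast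
  then obtain y where y: "\<And>m. from_nat_into C m = \<rho> (y m)" by metis
  obtain w where w: "\<And>m. point \<rho> w m = \<rho> (y m)" "modulus w = h" "base_code w = g"
    using code_exists[of \<rho> y h g] by blast
  have "w \<in> codes" using h by (simp add: codes_def w y)
  moreover have "decode w = F"
  proof -
    have rw: "range (point \<rho> w) = C"
    proof -
      have "point \<rho> w = from_nat_into C" by (rule ext) (simp add: w(1) y)
      then show ?thesis using r by simp
    qed
    obtain K where K: "closedin mtopology K" "F = X \<inter> K"
      using F(1) unfolding sub[symmetric] closedin_subtopology by auto
    have "mtopology closure_of C \<subseteq> K"
      using CF K by (intro closure_of_minimal) auto
    moreover have "F \<subseteq> mtopology closure_of C"
    proof
      fix p assume p: "p \<in> F"
      have "\<exists>c\<in>C. c \<in> mball p r" if r: "r > 0" for r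
      proof -
        obtain n where n: "(1/2::real)^n < r"
          using real_arch_pow_inv[of r "1/2"] r by auto
        obtain c where "c \<in> net n F" "d c p < (1/2)^n" using net(3)[OF p] by blast
        moreover have "c \<in> C" using \<open>c \<in> net n F\<close> by (auto simp: C_def)
        ultimately show ?thesis
          using n p FM CF by (intro bexI[of _ c]) (auto simp: commute)
      qed
      then show "p \<in> mtopology closure_of C"
        using p FM by (auto simp: metric_closure_of)
    qed
    ultimately show ?thesis
      unfolding decode_def rw K(2) by blast
  qed
  ultimately show thesis using that w(3) by blast
qed

text \<open>The condition on the pair of \<open>w\<close> and \<open>q\<close> is Borel, and the
  quantifier over \<open>q\<close> is a projection along the Baire space.\<close>

lemma analytic_not_zero_dimensional:
  "analytic_in Baire_space {w. \<exists>q. \<rho> q \<in> decode w \<and> \<not> codes_clopen_base b (base_code w) (\<rho> q)}"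
proof -
  \<comment> \<open>Radii are restricted to powers of \<open>1/2\<close>, to have countable
    quantifiers only.\<close>
  have cls: "\<rho> q \<in> decode w \<longleftrightarrow> (\<forall>k. \<exists>m. d (\<rho> q) (point \<rho> w m) < (1/2)^k)" for q w
  proof -
    have qM: "\<rho> q \<in> X" "\<rho> q \<in> M" using range_\<rho> XM by auto
    have "\<rho> q \<in> decode w \<longleftrightarrow> (\<forall>r>0. \<exists>m. d (\<rho> q) (point \<rho> w m) < r)"
      using qM point_M by (auto simp: decode_def metric_closure_of)
    also have "\<dots> \<longleftrightarrow> (\<forall>k. \<exists>m. d (\<rho> q) (point \<rho> w m) < (1/2)^k)"
    proof (intro iffI allI impI)
      fix r :: real assume *: "\<forall>k. \<exists>m. d (\<rho> q) (point \<rho> w m) < (1/2)^k" and "r > 0"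
      then obtain n where n: "(1/2::real)^n < r"
        using real_arch_pow_inv[of r "1/2"] by auto
      obtain m where "d (\<rho> q) (point \<rho> w m) < (1/2)^n" using * by blast
      with n show "\<exists>m. d (\<rho> q) (point \<rho> w m) < r" by (intro exI[of _ m]) simp
    qed auto
    finally show ?thesis .
  qed
  have [measurable]: "Measurable.pred borel
      (\<lambda>u::(nat \<Rightarrow> nat) \<times> (nat \<Rightarrow> nat). d (\<rho> (snd u)) (point \<rho> (fst u) m) < (1/2)^k)" for m k
  proof -
    have "open {u::(nat \<Rightarrow> nat) \<times> (nat \<Rightarrow> nat). d (\<rho> (snd u)) (point \<rho> (fst u) m) < (1/2)^k}"
      unfolding point_def
      by (intro open_Collect_less continuous_on_d continuous_on_const continuous_on_snd continuous_on_id
          continuous_on_compose2[OF continuous_on_slice continuous_on_fst[OF continuous_on_id]]) auto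
    then show ?thesis by (simp add: pred_def)
  qed
  have [measurable]: "Measurable.pred borel (\<lambda>u::(nat \<Rightarrow> nat) \<times> (nat \<Rightarrow> nat). \<rho> (snd u) \<in> b l)" for l
  proof -
    have "open ((\<lambda>u::(nat \<Rightarrow> nat) \<times> (nat \<Rightarrow> nat). \<rho> (snd u)) -` b l)"
      by (intro open_vimage open_b continuous_on_compose2[OF cont_\<rho> continuous_on_snd[OF continuous_on_id]]) auto
    then show ?thesis by (simp add: pred_def vimage_def)
  qed
  have [measurable]: "Measurable.pred borel (\<lambda>u::(nat \<Rightarrow> nat) \<times> (nat \<Rightarrow> nat). base_code (fst u) m = c)" for m c
  proof -
    have "continuous_on UNIV (\<lambda>u::(nat \<Rightarrow> nat) \<times> (nat \<Rightarrow> nat). fst u (prod_encode (1, m)))"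
      by (rule continuous_on_product_then_coordinatewise) (intro continuous_on_fst continuous_on_id)
    then have "open ((\<lambda>u::(nat \<Rightarrow> nat) \<times> (nat \<Rightarrow> nat). fst u (prod_encode (1, m))) -` {c})"
      by (intro open_vimage) (simp_all add: open_discrete)
    then show ?thesis by (simp add: pred_def vimage_def base_code_def)
  qed
  let ?S = "{u::(nat \<Rightarrow> nat) \<times> (nat \<Rightarrow> nat). \<rho> (snd u) \<in> decode (fst u) \<and>
    \<not> codes_clopen_base b (base_code (fst u)) (\<rho> (snd u))}"
  have "Measurable.pred borel (\<lambda>u::(nat \<Rightarrow> nat) \<times> (nat \<Rightarrow> nat). \<rho> (snd u) \<in> decode (fst u) \<and>
    \<not> codes_clopen_base b (base_code (fst u)) (\<rho> (snd u)))"
    unfolding cls codes_clopen_base_def in_code_def out_code_def by measurable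
  then have "?S \<in> sets borel" by (simp add: pred_def)
  then have "analytic_in (prod_topology Baire_space Baire_space) ?S"
    using analytic_in_borel[of ?S] metrizable_space_prod_topology[of Baire_space Baire_space]
      metrizable_Baire_space by simp
  then have "analytic_in Baire_space (fst ` ?S)"
    by (rule analytic_in_projection)
  moreover have "fst ` ?S = {w. \<exists>q. \<rho> q \<in> decode w \<and> \<not> codes_clopen_base b (base_code w) (\<rho> q)}"
    by (auto simp: image_def)
  ultimately show ?thesis by simp
qed

lemma zero_dim_decode_iff:
  "decode w \<in> zero_dim_closed_subsets (top_of_set X) \<longleftrightarrow>
    (\<exists>g. \<forall>x\<in>decode w. codes_clopen_base b g x)"
proof -
  have "subtopology (top_of_set X) (decode w) = top_of_set (decode w)"
    by (simp add: subtopology_subtopology decode_def Int_absorb1 inf.absorb2 Int_assoc[symmetric])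
  then show ?thesis
    using closedin_decode zero_dimensional_iff_code[OF open_b base_b, of "decode w"]
    by (simp add: zero_dim_closed_subsets_def closed_subsets_def)
qed

text \<open>A point \<open>y\<close> lies in the image of the nonempty zero-dimensional sets if and
  only if some code \<open>w\<close> satisfies \<open>y = e (decode w)\<close> and its row
  \<open>base_code w\<close> describes a clopen base. This is a coanalytic condition on
  \<open>(y, w)\<close>.\<close>

lemma Sigma12_in_zero_dim:
  assumes P: "metrizable_space P"
    and e: "continuous_map (pullback_topology (closed_subsets (top_of_set X))
      (\<lambda>F. mtopology closure_of F) (Vietoris mtopology)) P e"
  shows "Sigma12_in P (e ` zero_dim_closed_subsets (top_of_set X))"
proof -
  let ?H = "pullback_topology (closed_subsets (top_of_set X)) (\<lambda>F. mtopology closure_of F) (Vietoris mtopology)"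
  let ?PB = "prod_topology P Baire_space"
  let ?Z0 = "zero_dim_closed_subsets (top_of_set X)"
  have topH: "topspace ?H = closed_subsets (top_of_set X)"
    unfolding topspace_pullback_topology topspace_Vietoris
    using comp by (auto simp: closedin_compact_space)
  have eP: "e F \<in> topspace P" if "closedin (top_of_set X) F" for F
    using continuous_map_image_subset_topspace[OF e] that unfolding topH by (auto simp: closed_subsets_def)
  have metPB: "metrizable_space ?PB"
    using P by (simp add: metrizable_space_prod_topology metrizable_Baire_space)
  \<comment> \<open>The graph of the continuous map \<open>e \<circ> decode\<close> with its
    coordinates exchanged; it is closed because \<open>codes\<close> is closed and \<open>P\<close>
    is Hausdorff.\<close>
  define \<Gamma> where "\<Gamma> = {u \<in> topspace P \<times> codes. fst u = e (decode (snd u))}"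
  have "closedin (prod_topology P (top_of_set codes))
      {u \<in> topspace (prod_topology P (top_of_set codes)). fst u = (e \<circ> decode) (snd u)}"
  proof (rule closedin_continuous_maps_eq)
    show "Hausdorff_space P" using P by (rule metrizable_imp_Hausdorff_space)
    show "continuous_map (prod_topology P (top_of_set codes)) P fst" by (rule continuous_map_fst)
    show "continuous_map (prod_topology P (top_of_set codes)) P (\<lambda>u. (e \<circ> decode) (snd u))"
      using continuous_map_compose[OF continuous_map_snd continuous_map_compose[OF continuous_map_decode e]]
      by (simp add: o_def)
  qed
  moreover have "{u \<in> topspace (prod_topology P (top_of_set codes)). fst u = (e \<circ> decode) (snd u)} = \<Gamma>"
    by (auto simp: \<Gamma>_def)
  ultimately have "closedin (subtopology ?PB (topspace P \<times> codes)) \<Gamma>"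
    by (simp only: prod_topology_subtopology)
  moreover have "closedin ?PB (topspace P \<times> codes)"
    using closed_codes by (simp add: closedin_prod_Times_iff)
  ultimately have \<Gamma>: "closedin ?PB \<Gamma>" by (rule closedin_trans_full)
  define Z where "Z = {w. \<exists>q. \<rho> q \<in> decode w \<and> \<not> codes_clopen_base b (base_code w) (\<rho> q)}"
  \<comment> \<open>The value \<open>e {}\<close> is added by hand: a code lists points, so it never
    decodes to the empty set.\<close>
  define B where "B = {u \<in> topspace ?PB. fst u = e {} \<or> u \<in> \<Gamma> \<and> snd u \<notin> Z}"
  have "coanalytic_in ?PB B"
  proof -
    have "analytic_in ?PB {u \<in> topspace ?PB. snd u \<in> Z}"
      using analytic_in_preimage[OF analytic_not_zero_dimensional continuous_map_snd] by (simp add: Z_def)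
    moreover have "analytic_in ?PB (topspace ?PB - \<Gamma>)"
      by (rule analytic_in_openin[OF metPB openin_diff[OF openin_topspace \<Gamma>]])
    moreover have "analytic_in ?PB {u \<in> topspace ?PB. fst u \<in> topspace P - {e {}}}"
    proof (intro analytic_in_openin metPB openin_continuous_map_preimage[OF continuous_map_fst])
      have "closedin P {e {}}"
        using metrizable_imp_t1_space[OF P] eP[of "{}"] by (simp add: closedin_t1_singleton)
      then show "openin P (topspace P - {e {}})" by auto
    qed
    ultimately have "analytic_in ?PB ({u \<in> topspace ?PB. fst u \<in> topspace P - {e {}}} \<inter>
        ((topspace ?PB - \<Gamma>) \<union> {u \<in> topspace ?PB. snd u \<in> Z}))"
      by (intro analytic_in_Int analytic_in_Un)
    moreover have "\<dots> = topspace ?PB - B"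
      by (auto simp: B_def)
    ultimately show ?thesis by (auto simp: coanalytic_in_def B_def)
  qed
  moreover have "e ` ?Z0 = fst ` B"
  proof (intro subset_antisym subsetI)
    fix y assume "y \<in> e ` ?Z0"
    then obtain F where F: "F \<in> ?Z0" "y = e F" by blast
    then have cl: "closedin (top_of_set X) F" by (simp add: zero_dim_closed_subsets_def closed_subsets_def)
    show "y \<in> fst ` B"
    proof (cases "F = {}")
      case True
      then have "(y, undefined) \<in> B"
        using F(2) eP[OF cl] by (auto simp: B_def)
      then show ?thesis by force
    next
      case False
      \<comment> \<open>The code \<open>w0\<close> only serves to obtain \<open>g\<close>; a second
        code of the same set then carries this \<open>g\<close> in its row \<open>1\<close>.\<close>
      obtain w0 where w0: "w0 \<in> codes" "decode w0 = F"
        using decode_surj[OF cl False] by blast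
      then obtain g where g: "\<forall>x\<in>F. codes_clopen_base b g x"
        using zero_dim_decode_iff[of w0] F(1) by auto
      obtain w where w: "w \<in> codes" "decode w = F" "base_code w = g"
        using decode_surj[OF cl False] by blast
      then have "(y, w) \<in> B"
        using F(2) eP[OF cl] g by (auto simp: B_def \<Gamma>_def Z_def)
      then show ?thesis by force
    qed
  next
    fix y assume "y \<in> fst ` B"
    then obtain w where w: "(y, w) \<in> B" by force
    show "y \<in> e ` ?Z0"
    proof (cases "y = e {}")
      case True
      have "{} \<in> ?Z0"
        by (auto simp: zero_dim_closed_subsets_def closed_subsets_def zero_dimensional_def)
      with True show ?thesis by blast
    next
      case False
      with w have y: "y = e (decode w)" and wZ: "w \<notin> Z"
        by (auto simp: B_def \<Gamma>_def)
      have "codes_clopen_base b (base_code w) x" if "x \<in> decode w" for x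
      proof -
        have "x \<in> X" using that by (simp add: decode_def)
        then obtain q where "x = \<rho> q" using range_\<rho> by blast
        with that wZ show ?thesis by (auto simp: Z_def)
      qed
      then have "decode w \<in> ?Z0" using zero_dim_decode_iff by blast
      with y show ?thesis by blast
    qed
  qed
  ultimately show ?thesis unfolding Sigma12_in_def by blast
qed

end

lemma embedding_map_pullback_topology:
  assumes "inj_on f A" "f ` A \<subseteq> topspace Y"
  shows "embedding_map (pullback_topology A f Y) Y f"
proof -
  have top: "topspace (pullback_topology A f Y) = A"
    using assms(2) by (auto simp: topspace_pullback_topology)
  have "homeomorphic_map (pullback_topology A f Y) (subtopology Y (f ` A)) f"
  proof (rule bijective_open_imp_homeomorphic_map)
    have "continuous_map (pullback_topology A f Y) Y f"
      using continuous_map_pullback[OF continuous_map_id, of A f Y] by simp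
    then show "continuous_map (pullback_topology A f Y) (subtopology Y (f ` A)) f"
      by (auto simp: continuous_map_in_subtopology top)
    show "open_map (pullback_topology A f Y) (subtopology Y (f ` A)) f"
      unfolding open_map_def openin_pullback_topology openin_subtopology by auto
    show "f ` topspace (pullback_topology A f Y) = topspace (subtopology Y (f ` A))"
      using assms(2) top by auto
    show "inj_on f (topspace (pullback_topology A f Y))"
      using assms(1) top by simp
  qed
  then show ?thesis by (simp add: embedding_map_def top)
qed

text \<open>The hyperspace of the compactification is compact and metrizable, so it is a Polish
  space in which \<open>H\<close> embeds. The complexity bound holds for every embedding, as each
  one is continuous.\<close>

lemma Sigma12_subset_zero_dim_closed_subsets:
  assumes "admissible_topology (top_of_set X_infinity) H"
  shows "Sigma12_subset H (zero_dim_closed_subsets (top_of_set X_infinity))"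
proof -
  obtain T where T: "compact_space T" "metrizable_space T" "X_infinity \<subseteq> topspace T"
    "subtopology T X_infinity = top_of_set X_infinity"
    and H: "H = pullback_topology (closed_subsets (top_of_set X_infinity)) (\<lambda>F. T closure_of F) (Vietoris T)"
    using assms unfolding admissible_topology_def by auto
  obtain M d where "Metric_space M d" and Td: "T = Metric_space.mtopology M d"
    using T(2) unfolding metrizable_space_def by blast
  then interpret Metric_space M d by simp
  have comp: "compact_space mtopology" and XM: "X_infinity \<subseteq> M"
    and sub: "subtopology mtopology X_infinity = top_of_set X_infinity"
    using T Td by auto
  \<comment> \<open>Only a nonempty set can be parametrized by the Baire space.\<close>
  have "(\<lambda>_. True, 0) \<in> X_infinity"
    by (auto simp: X_infinity_def sparse_seqs_def)
  then have "X_infinity \<noteq> {}" by blast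
  then obtain \<rho> :: "(nat \<Rightarrow> nat) \<Rightarrow> (nat \<Rightarrow> bool) \<times> real"
    where \<rho>: "continuous_on UNIV \<rho>" "range \<rho> = X_infinity"
    by (rule analytic_Baire_image[OF analytic_X_infinity])
  obtain b :: "nat \<Rightarrow> ((nat \<Rightarrow> bool) \<times> real) set"
    where b: "\<forall>n. open (b n)" "\<forall>U. open U \<longrightarrow> (\<exists>u. U = (\<Union>n\<in>Collect u. b n))"
    using base_sequence by blast
  interpret coded_hyperspace M d X_infinity \<rho> b
    using comp XM sub \<rho> b by unfold_locales auto
  have compV: "compact_space (Vietoris T)" and metV: "metrizable_space (Vietoris T)"
    using compact_space_Vietoris metrizable_space_Vietoris comp Td by auto
  have clos: "T closure_of F \<in> topspace (Vietoris T)" for F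
    using T(1) by (simp add: topspace_Vietoris closedin_compact_space)
  have emb: "embedding_map H (Vietoris T) (\<lambda>F. T closure_of F)"
    unfolding H
  proof (rule embedding_map_pullback_topology)
    \<comment> \<open>A relatively closed set is recovered from its closure, so taking closures is
      injective.\<close>
    have "X_infinity \<inter> T closure_of F = F" if F: "F \<in> closed_subsets (top_of_set X_infinity)" for F
    proof -
      obtain K where "closedin T K" "F = K \<inter> X_infinity"
        using F unfolding closed_subsets_def T(4)[symmetric] closedin_subtopology by auto
      then show ?thesis
        using closure_of_minimal[of F K T] closure_of_subset[of F T] T(3) by auto
    qed
    then show "inj_on (\<lambda>F. T closure_of F) (closed_subsets (top_of_set X_infinity))"
      by (intro inj_onI) metis
  qed (use clos in auto)
  show ?thesis
    unfolding Sigma12_subset_def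
  proof (intro conjI)
    show "zero_dim_closed_subsets (top_of_set X_infinity) \<subseteq> topspace H"
      using clos by (auto simp: H topspace_pullback_topology zero_dim_closed_subsets_def)
    have all: "Sigma12_in P (e ` zero_dim_closed_subsets (top_of_set X_infinity))"
      if "Polish_space P" "embedding_map H P e" for P :: "((nat \<Rightarrow> bool) \<times> real) set topology" and e
    proof (rule Sigma12_in_zero_dim)
      show "metrizable_space P"
        using that(1) completely_metrizable_imp_metrizable_space by (auto simp: Polish_space_def)
      show "continuous_map (pullback_topology (closed_subsets (top_of_set X_infinity))
          (\<lambda>F. mtopology closure_of F) (Vietoris mtopology)) P e"
        using homeomorphic_imp_continuous_map[OF that(2)[unfolded embedding_map_def]]
        unfolding H Td continuous_map_in_subtopology by (rule conjunct1)
    qed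
    then show "\<forall>(P :: ((nat \<Rightarrow> bool) \<times> real) set topology) e. Polish_space P \<and> embedding_map H P e \<longrightarrow>
        Sigma12_in P (e ` zero_dim_closed_subsets (top_of_set X_infinity))"
      by blast
    show "\<exists>(P :: ((nat \<Rightarrow> bool) \<times> real) set topology) e. Polish_space P \<and> embedding_map H P e \<and>
        Sigma12_in P (e ` zero_dim_closed_subsets (top_of_set X_infinity))"
      using all Polish_space_compact[OF compV metV] emb by blast
  qed
qed

theorem theorem1p1:
  shows "\<exists>X :: ((nat \<Rightarrow> bool) \<times> real) set.
    X \<subseteq> UNIV \<times> {0..1} \<and>
    analytic_space (top_of_set X) \<and>
    (\<forall>H. admissible_topology (top_of_set X) H \<longrightarrow>
       Sigma12_complete H (zero_dim_closed_subsets (top_of_set X)))"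
proof (intro exI conjI allI impI)
  show "X_infinity \<subseteq> UNIV \<times> {0..1}"
    by (auto simp: X_infinity_def)
  show "analytic_space (top_of_set X_infinity)"
    unfolding analytic_space_def
    using Polish_space_Cantor_real analytic_X_infinity homeomorphic_space_refl by blast
  show "Sigma12_complete H (zero_dim_closed_subsets (top_of_set X_infinity))"
    if "admissible_topology (top_of_set X_infinity) H" for H
    unfolding Sigma12_complete_def
    using that Sigma12_hard_zero_dim_closed_subsets Sigma12_subset_zero_dim_closed_subsets by blast
qed

end
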